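(* Let $m$ be a non-negative integer and $\alpha\in\mathbb{C}$. For $z\in(1,\infty)$ and $\xi\in(0,\infty)$, $$\hat Q_{-\frac12+\alpha}^{\pm(\frac12+m)}(z)=\sqrt{\frac\pi2}\;m!\left[1\,\Big|\,\frac1{(\alpha-m)_{2m+1}}\right]_\pm(z^2-1)^{-1/4}\left(z+\sqrt{z^2-1}\right)^{-\alpha}P_m^{(\alpha,-\alpha)}\!\left(\frac z{\sqrt{z^2-1}}\right),$$ $$\hat Q_{-\frac12+\alpha}^{\pm(\frac12+m)}(\cosh\xi)=\sqrt{\frac\pi2}\;m!\left[1\,\Big|\,\frac1{(\alpha-m)_{2m+1}}\right]_\pm(\sinh\xi)^{-1/2}\,{\rm e}^{-\alpha\xi}\,P_m^{(\alpha,-\alpha)}(\coth\xi),$$ where $\hat Q_\nu^\mu$ is the normalized second-kind Legendre function, $P_m^{(\alpha,\beta)}$ is the Jacobi polynomial, and $[A|B]_\pm$ signifies $A$ in the $+$ case and $B$ in the $-$ case.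
   Context: $\hat Q_\nu^\mu:=e^{-\mu\pi{\rm i}}Q_\nu^\mu$, where $Q_\nu^\mu$ is the usual associated Legendre function of the second kind; explicitly, for $z>1$, $$\hat Q_\nu^\mu(z)=\frac{\sqrt\pi}{2^{\nu+1}}\frac{\Gamma(\nu+\mu+1)}{\Gamma(\nu+3/2)}\frac{(z^2-1)^{\mu/2}}{z^{\nu+\mu+1}}\,{}_2F_1\!\left(\tfrac\nu2+\tfrac\mu2+\tfrac12,\tfrac\nu2+\tfrac\mu2+1;\nu+\tfrac32;\tfrac1{z^2}\right),$$ a limit being taken when $\nu+\frac32$ is a non-positive integer. The function $\hat Q_{-\frac12+\alpha}^{+(\frac12+m)}$ is defined for all $\alpha$, while $\hat Q_{-\frac12+\alpha}^{-(\frac12+m)}$ is undefined if and only if $\alpha\in\{-m,\dots,m\}$, i.e. iff $(\alpha-m)_{2m+1}=(\alpha-m)\cdots(\alpha+m)=0$; those values of $\alpha$ are excluded in the $-$ case. The Jacobi polynomials, for arbitrary complex $\alpha,\beta$, are given by $P_n^{(\alpha,\beta)}(z)=\frac{(-1)^n}{2^nn!}(1-z)^{-\alpha}(1+z)^{-\beta}\frac{{\rm d}^n}{{\rm d}z^n}\left[(1-z)^{\alpha+n}(1+z)^{\beta+n}\right]$. *)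

theory Defs
  imports "HOL-Analysis.Analysis"
begin

section \<open>Legendre function of the second kind\<close>

definition hyp2F1 :: "complex \<Rightarrow> complex \<Rightarrow> complex \<Rightarrow> complex \<Rightarrow> complex" where
  "hyp2F1 a b c x = eval_fps (fps_hypergeo [a, b] [c] 1) x"

text \<open>The explicit formula, meaningful when \<open>\<nu> + 3/2\<close> is not a non-positive integer.\<close>

definition legendre_Qhat_generic :: "complex \<Rightarrow> complex \<Rightarrow> real \<Rightarrow> complex" where
  "legendre_Qhat_generic \<nu> \<mu> z =
     of_real (sqrt pi) / 2 powr (\<nu> + 1)
     * (Gamma (\<nu> + \<mu> + 1) / Gamma (\<nu> + 3/2))
     * (of_real (z^2 - 1) powr (\<mu> / 2) / of_real z powr (\<nu> + \<mu> + 1))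
     * hyp2F1 (\<nu>/2 + \<mu>/2 + 1/2) (\<nu>/2 + \<mu>/2 + 1) (\<nu> + 3/2) (of_real (1 / z^2))"

text \<open>
  The normalised function \<open>exp (- \<mu> \<pi> \<i>) Q\<^sub>\<nu>\<^sup>\<mu>(z)\<close> for \<open>z > 1\<close>.  At the exceptional values of \<open>\<nu>\<close>
  the limit is taken in the degree, the order \<open>\<mu>\<close> being held fixed.  This matters when
  \<open>Gamma (\<nu> + \<mu> + 1)\<close> has a pole at the same place, as happens for \<open>\<mu> = \<plusminus>(1/2 + m)\<close> and
  \<open>\<nu> = -1/2 - k\<close> with \<open>k > m\<close>: the limit in \<open>\<nu>\<close> exists there, but no joint limit in \<open>(\<nu>, \<mu>)\<close> does.
\<close>

definition legendre_Qhat :: "complex \<Rightarrow> complex \<Rightarrow> real \<Rightarrow> complex" where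
  "legendre_Qhat \<nu> \<mu> z =
     (if \<nu> + 3/2 \<in> \<int>\<^sub>\<le>\<^sub>0 then Lim (at \<nu>) (\<lambda>\<nu>'. legendre_Qhat_generic \<nu>' \<mu> z)
      else legendre_Qhat_generic \<nu> \<mu> z)"


section \<open>Jacobi polynomials with complex parameters\<close>

text \<open>
  The right-hand side of Rodrigues' formula uses principal powers, so it only makes sense literally
  off the cuts \<open>(-\<infinity>, -1]\<close> and \<open>[1, \<infinity>)\<close>.  There it is a polynomial in \<open>z\<close>, and
  the Jacobi polynomial is that polynomial; it may then be evaluated at any point, in particular
  on \<open>(1, \<infinity>)\<close>.
\<close>

definition rodrigues :: "nat \<Rightarrow> complex \<Rightarrow> complex \<Rightarrow> complex \<Rightarrow> complex" where
  "rodrigues n \<alpha> \<beta> z =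
     (-1)^n / (2^n * fact n) * (1 - z) powr (-\<alpha>) * (1 + z) powr (-\<beta>)
     * (deriv ^^ n) (\<lambda>w. (1 - w) powr (\<alpha> + of_nat n) * (1 + w) powr (\<beta> + of_nat n)) z"

definition jacobi_poly :: "nat \<Rightarrow> complex \<Rightarrow> complex \<Rightarrow> complex poly" where
  "jacobi_poly n \<alpha> \<beta> =
     (THE p. \<forall>z. 1 - z \<notin> \<real>\<^sub>\<le>\<^sub>0 \<longrightarrow> 1 + z \<notin> \<real>\<^sub>\<le>\<^sub>0 \<longrightarrow> poly p z = rodrigues n \<alpha> \<beta> z)"

text \<open>The description is proper: existence and uniqueness.\<close>

lemma open_off_cuts: "open {z::complex. 1 - z \<notin> \<real>\<^sub>\<le>\<^sub>0 \<and> 1 + z \<notin> \<real>\<^sub>\<le>\<^sub>0}"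
proof -
  have "open ((\<lambda>z::complex. 1 - z) -` (- \<real>\<^sub>\<le>\<^sub>0) \<inter> (\<lambda>z. 1 + z) -` (- \<real>\<^sub>\<le>\<^sub>0))"
    by (intro open_Int open_vimage open_Compl closed_nonpos_Reals_complex continuous_intros)
  also have "(\<lambda>z::complex. 1 - z) -` (- \<real>\<^sub>\<le>\<^sub>0) \<inter> (\<lambda>z. 1 + z) -` (- \<real>\<^sub>\<le>\<^sub>0)
             = {z::complex. 1 - z \<notin> \<real>\<^sub>\<le>\<^sub>0 \<and> 1 + z \<notin> \<real>\<^sub>\<le>\<^sub>0}"
    by auto
  finally show ?thesis .
qed

lemma higher_deriv_jacobi_weight:
  fixes a b :: complex
  shows "\<exists>q. \<forall>z. 1 - z \<notin> \<real>\<^sub>\<le>\<^sub>0 \<longrightarrow> 1 + z \<notin> \<real>\<^sub>\<le>\<^sub>0 \<longrightarrow>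
           (deriv ^^ k) (\<lambda>w. (1 - w) powr a * (1 + w) powr b) z
           = (1 - z) powr (a - of_nat k) * (1 + z) powr (b - of_nat k) * poly q z"
proof (induction k)
  case 0
  show ?case by (rule exI[of _ 1]) simp
next
  case (Suc k)
  define A where "A = a - of_nat k"
  define B where "B = b - of_nat k"
  define f where "f = (deriv ^^ k) (\<lambda>w. (1 - w) powr a * (1 + w) powr b)"
  obtain q where q: "\<And>z. 1 - z \<notin> \<real>\<^sub>\<le>\<^sub>0 \<Longrightarrow> 1 + z \<notin> \<real>\<^sub>\<le>\<^sub>0 \<Longrightarrow>
      f z = (1 - z) powr A * (1 + z) powr B * poly q z"
    using Suc unfolding A_def B_def f_def by blast
  define r where "r = [:1, 0, -1:] * pderiv q + (smult (-A) [:1, 1:] + smult B [:1, -1:]) * q"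
  have "deriv f z = (1 - z) powr (A - 1) * (1 + z) powr (B - 1) * poly r z"
    if z: "1 - z \<notin> \<real>\<^sub>\<le>\<^sub>0" "1 + z \<notin> \<real>\<^sub>\<le>\<^sub>0" for z
  proof -
    have "eventually (\<lambda>w. w \<in> {w. 1 - w \<notin> \<real>\<^sub>\<le>\<^sub>0 \<and> 1 + w \<notin> \<real>\<^sub>\<le>\<^sub>0}) (nhds z)"
      using z by (intro eventually_nhds_in_open open_off_cuts) auto
    then have ev: "eventually (\<lambda>w. f w = (1 - w) powr A * (1 + w) powr B * poly q w) (nhds z)"
      by eventually_elim (use q in auto)
    have D: "((\<lambda>w. (1 - w) powr A * (1 + w) powr B * poly q w) has_field_derivative
        ((A * (1 - z) powr (A - 1) * (-1)) * (1 + z) powr B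
          + (B * (1 + z) powr (B - 1)) * (1 - z) powr A) * poly q z
        + poly (pderiv q) z * ((1 - z) powr A * (1 + z) powr B)) (at z)"
      using z by (auto intro!: derivative_eq_intros)
    have nz: "1 - z \<noteq> 0" "1 + z \<noteq> 0" using z by auto
    have e: "(1 - z) powr A = (1 - z) * (1 - z) powr (A - 1)"
            "(1 + z) powr B = (1 + z) * (1 + z) powr (B - 1)"
      using nz by (simp_all add: powr_diff)
    have "deriv f z = ((A * (1 - z) powr (A - 1) * (-1)) * (1 + z) powr B
          + (B * (1 + z) powr (B - 1)) * (1 - z) powr A) * poly q z
        + poly (pderiv q) z * ((1 - z) powr A * (1 + z) powr B)"
      using deriv_cong_ev[OF ev refl] DERIV_imp_deriv[OF D] by simp
    also have "\<dots> = (1 - z) powr (A - 1) * (1 + z) powr (B - 1) * poly r z"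
      unfolding e r_def by (simp add: algebra_simps)
    finally show ?thesis .
  qed
  then show ?case
    by (intro exI[of _ r]) (simp add: A_def B_def f_def algebra_simps)
qed

lemma jacobi_poly_ex1:
  "\<exists>!p. \<forall>z. 1 - z \<notin> \<real>\<^sub>\<le>\<^sub>0 \<longrightarrow> 1 + z \<notin> \<real>\<^sub>\<le>\<^sub>0 \<longrightarrow> poly p z = rodrigues n \<alpha> \<beta> z"
proof (rule ex_ex1I)
  obtain q where q: "\<And>z. 1 - z \<notin> \<real>\<^sub>\<le>\<^sub>0 \<Longrightarrow> 1 + z \<notin> \<real>\<^sub>\<le>\<^sub>0 \<Longrightarrow>
      (deriv ^^ n) (\<lambda>w. (1 - w) powr (\<alpha> + of_nat n) * (1 + w) powr (\<beta> + of_nat n)) z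
      = (1 - z) powr \<alpha> * (1 + z) powr \<beta> * poly q z"
    using higher_deriv_jacobi_weight[of n "\<alpha> + of_nat n" "\<beta> + of_nat n"] by auto
  have "poly (smult ((-1)^n / (2^n * fact n)) q) z = rodrigues n \<alpha> \<beta> z"
    if z: "1 - z \<notin> \<real>\<^sub>\<le>\<^sub>0" "1 + z \<notin> \<real>\<^sub>\<le>\<^sub>0" for z
  proof -
    have nz: "1 - z \<noteq> 0" "1 + z \<noteq> 0" using z by auto
    show ?thesis
      unfolding rodrigues_def q[OF z] using nz by (simp add: powr_minus field_simps)
  qed
  then show "\<exists>p. \<forall>z. 1 - z \<notin> \<real>\<^sub>\<le>\<^sub>0 \<longrightarrow> 1 + z \<notin> \<real>\<^sub>\<le>\<^sub>0 \<longrightarrow> poly p z = rodrigues n \<alpha> \<beta> z"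
    by blast
next
  fix p q
  assume p: "\<forall>z. 1 - z \<notin> \<real>\<^sub>\<le>\<^sub>0 \<longrightarrow> 1 + z \<notin> \<real>\<^sub>\<le>\<^sub>0 \<longrightarrow> poly p z = rodrigues n \<alpha> \<beta> z"
    and q: "\<forall>z. 1 - z \<notin> \<real>\<^sub>\<le>\<^sub>0 \<longrightarrow> 1 + z \<notin> \<real>\<^sub>\<le>\<^sub>0 \<longrightarrow> poly q z = rodrigues n \<alpha> \<beta> z"
  have "infinite {z::complex. 1 - z \<notin> \<real>\<^sub>\<le>\<^sub>0 \<and> 1 + z \<notin> \<real>\<^sub>\<le>\<^sub>0}"
    using finite_imp_not_open[OF _ _] open_off_cuts by (metis (mono_tags, lifting) diff_zero add_0_right complex_nonpos_Reals_iff empty_iff mem_Collect_eq one_complex.sel(1) zero_less_one not_le)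
  then have "infinite {z. poly (p - q) z = 0}"
    by (rule infinite_super[rotated]) (use p q in auto)
  then show "p = q"
    using poly_roots_finite[of "p - q"] by auto
qed

lemma poly_jacobi_poly:
  assumes "1 - z \<notin> \<real>\<^sub>\<le>\<^sub>0" and "1 + z \<notin> \<real>\<^sub>\<le>\<^sub>0"
  shows "poly (jacobi_poly n \<alpha> \<beta>) z = rodrigues n \<alpha> \<beta> z"
  using theI'[OF jacobi_poly_ex1[of n \<alpha> \<beta>]] assms unfolding jacobi_poly_def by blast

end

theory Submission
  imports Defs "HOL-Complex_Analysis.Complex_Analysis"
begin

text \<open>
  Put \<open>x = 1 / z\<^sup>2\<close>, \<open>r = sqrt (1 - x)\<close>, \<open>t = (1 - r) / (1 + r)\<close>, so that \<open>x = 4 t / (1 + t)\<^sup>2\<close> and, for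
  \<open>z = cosh \<xi>\<close>, \<open>t = exp (-2 \<xi>)\<close>.  The quadratic transformation
  \<open>F(a/2, a/2 + 1/2; c; x) = (1 + t) powr a * F(a, a - c + 1; c; t)\<close> with \<open>c = \<alpha> + 1\<close> turns the
  hypergeometric factor of the \<open>-\<close> case (\<open>a = \<alpha> - m\<close>) into \<open>F(\<alpha> - m, -m; \<alpha> + 1; t)\<close>, a polynomial in \<open>t\<close>;
  in the \<open>+\<close> case (\<open>a = \<alpha> + m + 1\<close>) Euler's transformation leads to the same polynomial.  By
  Leibniz' rule in Rodrigues' formula, it is \<open>P\<^sub>m\<close> at \<open>1 / r = (1 + t) / (1 - t)\<close> up to elementary factors.
  The transformations are identities of formal power series at \<open>0\<close>, continued to \<open>\<bar>x\<bar> < 1\<close> by the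
  identity theorem.  At the exceptional degrees the right-hand side is continuous in \<open>\<alpha>\<close>, so it is the
  required limit.
\<close>

unbundle no vec_syntax

section \<open>Formal composition and convergence of the hypergeometric series\<close>

lemma pochhammer_nonzero:
  fixes c :: "'a :: field_char_0"
  assumes "c \<notin> \<int>\<^sub>\<le>\<^sub>0"
  shows "pochhammer c n \<noteq> 0"
  using assms by (auto simp: pochhammer_eq_0_iff)

lemma hyp2F1_commute: "hyp2F1 a b c x = hyp2F1 b a c x"
  by (simp add: hyp2F1_def eval_fps_def mult_ac)

text \<open>The formal counterpart of expanding F(r s (1 + s)^(-p)) (1 + s)^(-a): the i-th power of
  the inner series times (1 + s)^(-a) is r^i s^i (1 + s)^(-a - i p). Pfaff's transformation uses r =
  p = 1, the quadratic one r = 4 and p = 2.\<close>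

lemma fps_compose_binomial_nth:
  fixes F :: "'a :: field_char_0 fps"
  shows "(fps_compose F (fps_const r * fps_X * fps_binomial (-p)) * fps_binomial (-a)) $ k =
         (\<Sum>i\<le>k. F $ i * r ^ i * ((-a - of_nat i * p) gchoose (k - i)))"
proof -
  define G where "G = fps_const r * fps_X * fps_binomial (-p)"
  have G: "G ^ i * fps_binomial (-a) =
      fps_const (r ^ i) * (fps_X ^ i * fps_binomial (-a - of_nat i * p))" for i
  proof -
    have "fps_binomial (-a - of_nat i * p) = fps_binomial (of_nat i * (-p) + (-a))"
      by (rule arg_cong) simp
    also have "\<dots> = fps_binomial (-p) ^ i * fps_binomial (-a)"
      by (simp only: fps_binomial_add_mult fps_binomial_power)
    finally have "fps_binomial (-a - of_nat i * p) = fps_binomial (-p) ^ i * fps_binomial (-a)" .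
    then show ?thesis
      by (simp add: G_def power_mult_distrib mult.assoc)
  qed
  \<comment> \<open>\<open>G\<close> has no constant term, so the range of i can be extended to the
    common bound k; then the two sums can be interchanged.\<close>
  have G0: "(G ^ i) $ n = 0" if "n < i" for i n
    using that by (intro startsby_zero_power_prefix[THEN spec, THEN mp]) (auto simp: G_def)
  have "(fps_compose F G * fps_binomial (-a)) $ k =
      (\<Sum>j=0..k. (\<Sum>i\<le>k. F $ i * (G ^ i) $ j) * fps_binomial (-a) $ (k - j))"
    unfolding fps_mult_nth fps_compose_nth
    by (intro sum.cong refl arg_cong2[where f = times] sum.mono_neutral_left) (auto simp: G0)
  also have "\<dots> = (\<Sum>i\<le>k. F $ i * (G ^ i * fps_binomial (-a)) $ k)"
    unfolding fps_mult_nth sum_distrib_left sum_distrib_right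
    by (subst sum.swap) (simp only: mult.assoc)
  also have "\<dots> = (\<Sum>i\<le>k. F $ i * r ^ i * ((-a - of_nat i * p) gchoose (k - i)))"
    unfolding G by (intro sum.cong refl) (simp add: fps_X_power_mult_nth)
  finally show ?thesis by (simp only: G_def)
qed

lemma ratio_tendsto_1:
  fixes x y :: complex
  assumes y: "y \<notin> \<int>\<^sub>\<le>\<^sub>0"
  shows "(\<lambda>n. (of_nat n + x) / (of_nat n + y)) \<longlonglongrightarrow> 1"
proof -
  have "filterlim (\<lambda>n. of_nat n + y) at_infinity sequentially"
    by (rule tendsto_add_filterlim_at_infinity'[OF tendsto_of_nat tendsto_const])
  then have "(\<lambda>n. 1 + (x - y) / (of_nat n + y)) \<longlonglongrightarrow> 1 + 0"
    by (intro tendsto_add tendsto_const tendsto_divide_0[OF tendsto_const])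
  moreover have "1 + (x - y) / (of_nat n + y) = (of_nat n + x) / (of_nat n + y)" for n
  proof -
    have "of_nat n + y \<noteq> 0"
    proof
      assume "of_nat n + y = 0"
      then have "y = - of_nat n" by (simp add: eq_neg_iff_add_eq_0 add.commute)
      with y show False by simp
    qed
    then show ?thesis by (simp add: field_simps)
  qed
  ultimately show ?thesis by simp
qed

text \<open>The ratio test needs nonvanishing coefficients. If a or b is a non-positive integer, the
  series terminates and its radius is infinite; otherwise quotients of consecutive coefficients tend
  to 1.\<close>

lemma conv_radius_hypergeo:
  fixes a b c :: complex
  assumes c: "c \<notin> \<int>\<^sub>\<le>\<^sub>0"
  shows "fps_conv_radius (fps_hypergeo [a, b] [c] 1) \<ge> 1"
proof (cases "a \<in> \<int>\<^sub>\<le>\<^sub>0 \<or> b \<in> \<int>\<^sub>\<le>\<^sub>0")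
  case True
  then obtain k where k: "a = - of_nat k \<or> b = - of_nat k"
    by (metis nonpos_Ints_cases')
  have "eventually (\<lambda>n. fps_hypergeo [a, b] [c] 1 $ n = 0) sequentially"
    using eventually_gt_at_top[of k]
    by eventually_elim (use k in \<open>auto simp: pochhammer_of_nat_eq_0_iff\<close>)
  then have "fps_conv_radius (fps_hypergeo [a, b] [c] 1) = fps_conv_radius (0 :: complex fps)"
    unfolding fps_conv_radius_def by (intro conv_radius_cong') auto
  then show ?thesis by simp
next
  case False
  let ?f = "fps_nth (fps_hypergeo [a, b] [c] 1)"
  have nz: "pochhammer x n \<noteq> 0" if "x \<in> {a, b, c}" for x n
    using False c that by (auto simp: pochhammer_nonzero)
  have "?f n / ?f (Suc n) = ((of_nat n + c) / (of_nat n + a)) * ((of_nat n + 1) / (of_nat n + b))" for n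
  proof -
    have "x + of_nat n \<noteq> 0" if "x \<in> {a, b, c}" for x
      using nz[OF that, of "Suc n"] by (simp add: pochhammer_Suc)
    then show ?thesis
      using nz[of a n] nz[of b n] nz[of c n] by (simp add: pochhammer_Suc divide_simps) (simp add: algebra_simps)
  qed
  moreover have "(\<lambda>n. ((of_nat n + c) / (of_nat n + a)) * ((of_nat n + 1) / (of_nat n + b))) \<longlonglongrightarrow> 1 * 1"
    by (intro tendsto_mult ratio_tendsto_1) (use False in auto)
  ultimately have "(\<lambda>n. ?f n / ?f (Suc n)) \<longlonglongrightarrow> 1" by simp
  from tendsto_norm[OF this] have "(\<lambda>n. norm (?f n) / norm (?f (Suc n))) \<longlonglongrightarrow> 1"
    by (simp only: norm_divide norm_one)
  then show ?thesis
    unfolding fps_conv_radius_def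
    by (subst conv_radius_ratio_limit_nonzero[OF one_ereal_def]) auto
qed

lemma has_fps_expansion_hyp2F1:
  assumes "c \<notin> \<int>\<^sub>\<le>\<^sub>0"
  shows "hyp2F1 a b c has_fps_expansion fps_hypergeo [a, b] [c] 1"
proof -
  have "0 < fps_conv_radius (fps_hypergeo [a, b] [c] 1)"
    using conv_radius_hypergeo[OF assms, of a b] by (rule less_le_trans[rotated]) simp
  then show ?thesis
    unfolding has_fps_expansion_def by (simp add: hyp2F1_def)
qed

lemma holomorphic_hyp2F1:
  assumes "c \<notin> \<int>\<^sub>\<le>\<^sub>0"
  shows "hyp2F1 a b c holomorphic_on ball 0 1"
proof -
  have "ball 0 1 \<subseteq> eball (0 :: complex) (fps_conv_radius (fps_hypergeo [a, b] [c] 1))"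
  proof
    fix x :: complex
    assume "x \<in> ball 0 1"
    then have "ereal (norm x) < 1" by simp
    also note conv_radius_hypergeo[OF assms, of a b]
    finally show "x \<in> eball 0 (fps_conv_radius (fps_hypergeo [a, b] [c] 1))" by simp
  qed
  then have "eval_fps (fps_hypergeo [a, b] [c] 1) holomorphic_on ball 0 1"
    by (rule holomorphic_on_eval_fps)
  also have "eval_fps (fps_hypergeo [a, b] [c] 1) = hyp2F1 a b c"
    by (rule ext) (rule hyp2F1_def[symmetric])
  finally show ?thesis .
qed

lemma has_fps_expansion_eqD:
  assumes "f has_fps_expansion F" "g has_fps_expansion F"
  shows "eventually (\<lambda>x. f x = g x) (nhds 0)"
proof -
  have "eventually (\<lambda>x. eval_fps F x = f x) (nhds 0)" "eventually (\<lambda>x. eval_fps F x = g x) (nhds 0)"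
    using assms by (simp_all add: has_fps_expansion_def)
  then show ?thesis by eventually_elim simp
qed

section \<open>The Pfaff and quadratic transformations as formal identities\<close>

text \<open>Vandermonde's sum carries the quotient k! / (k - i)! in the form (-k)_i.\<close>

lemma pochhammer_neg_nat:
  assumes "i \<le> k"
  shows "pochhammer (- of_nat k :: 'a :: field_char_0) i = (-1) ^ i * fact k / fact (k - i)"
proof -
  have "fact k = (fact (k - i) * pochhammer (of_nat k - of_nat i + 1) i :: 'a)"
    using pochhammer_product[of "k - i" k "1 :: 'a"] assms
    by (simp add: algebra_simps flip: pochhammer_fact)
  then show ?thesis by (simp add: pochhammer_minus)
qed

text \<open>Expanding in powers of the inner variable turns both transformations into the
  Chu--Vandermonde identity.\<close>

lemma pfaff_fps:
  fixes a b c :: complex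
  assumes c: "c \<notin> \<int>\<^sub>\<le>\<^sub>0"
  shows "fps_compose (fps_hypergeo [a, c - b] [c] 1) (fps_const 1 * fps_X * fps_binomial (-1)) * fps_binomial (-a)
         = fps_hypergeo [a, b] [c] (-1)"
proof (rule fps_ext)
  fix k
  \<comment> \<open>The variable is s = -t, which turns t / (t - 1) into s / (1 + s) and accounts
    for the argument -1 on the right. Each summand is a factor free of i times a Vandermonde
    summand.\<close>
  have "fps_hypergeo [a, c - b] [c] 1 $ i * 1 ^ i * ((-a - of_nat i * 1) gchoose (k - i)) =
        ((-1) ^ k * pochhammer a k / fact k) * (pochhammer (c - b) i * pochhammer (- of_nat k) i / (of_nat (fact i) * pochhammer c i))"
    if "i \<le> k" for i
  proof -
    have 1: "pochhammer a k = pochhammer a i * pochhammer (a + of_nat i) (k - i)"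
      using that by (rule pochhammer_product)
    have 2: "(-1) ^ (k - i) = (-1 :: complex) ^ k * (-1) ^ i"
      using that by (simp add: minus_one_power_iff)
    have 3: "(- a - of_nat i gchoose (k - i)) = (-1) ^ (k - i) * pochhammer (a + of_nat i) (k - i) / fact (k - i)"
      by (simp add: gbinomial_pochhammer add.commute)
    show ?thesis
      using that pochhammer_nonzero[OF c, of i]
      by (simp add: 1 2 3 pochhammer_neg_nat divide_simps)
  qed
  then have "(fps_compose (fps_hypergeo [a, c - b] [c] 1) (fps_const 1 * fps_X * fps_binomial (-1)) * fps_binomial (-a)) $ k =
      (-1) ^ k * pochhammer a k / fact k *
      (\<Sum>i=0..k. pochhammer (c - b) i * pochhammer (- of_nat k) i / (of_nat (fact i) * pochhammer c i))"
    unfolding fps_compose_binomial_nth sum_distrib_left atMost_atLeast0 by (intro sum.cong) auto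
  also have "\<dots> = (-1) ^ k * pochhammer a k / fact k * (pochhammer b k / pochhammer c k)"
    using c by (subst Vandermonde_pochhammer) auto
  also have "\<dots> = fps_hypergeo [a, b] [c] (-1) $ k"
    by (simp add: mult_ac)
  finally show "(fps_compose (fps_hypergeo [a, c - b] [c] 1) (fps_const 1 * fps_X * fps_binomial (-1)) * fps_binomial (-a)) $ k =
      fps_hypergeo [a, b] [c] (-1) $ k" .
qed

lemma quadratic_fps:
  fixes a c :: complex
  assumes c: "c \<notin> \<int>\<^sub>\<le>\<^sub>0"
  shows "fps_compose (fps_hypergeo [a / 2, a / 2 + 1 / 2] [c] 1) (fps_const 4 * fps_X * fps_binomial (-2)) * fps_binomial (-a)
         = fps_hypergeo [a, a - c + 1] [c] 1"
proof (rule fps_ext)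
  fix k
  have "fps_hypergeo [a / 2, a / 2 + 1 / 2] [c] 1 $ i * 4 ^ i * ((-a - of_nat i * 2) gchoose (k - i)) =
        ((-1) ^ k * pochhammer a k / fact k) * (pochhammer (a + of_nat k) i * pochhammer (- of_nat k) i / (of_nat (fact i) * pochhammer c i))"
    if "i \<le> k" for i
  proof -
    \<comment> \<open>The duplication formula absorbs 4^i; this is where the constant 4 of the inner
      series comes from.\<close>
    have 0: "pochhammer (a / 2) i * pochhammer (a / 2 + 1 / 2) i * 4 ^ i = pochhammer a (2 * i)"
      using pochhammer_double[of "a / 2" i] by (simp add: power_mult)
    \<comment> \<open>Splitting (a)_(k+i) both at k and at 2 i trades the factors (a)_(2i) (a + 2
      i)_(k-i) for (a)_k (a + k)_i, whose first factor is free of i.\<close>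
    have "pochhammer a k * pochhammer (a + of_nat k) i = pochhammer a (k + i)"
      by (rule pochhammer_product'[symmetric])
    also have "k + i = 2 * i + (k - i)"
      using that by simp
    also have "pochhammer a \<dots> = pochhammer a (2 * i) * pochhammer (a + of_nat (2 * i)) (k - i)"
      by (rule pochhammer_product')
    finally have 1: "pochhammer a k * pochhammer (a + of_nat k) i = pochhammer a (2 * i) * pochhammer (a + 2 * of_nat i) (k - i)"
      by simp
    have 2: "(-1) ^ (k - i) = (-1 :: complex) ^ k * (-1) ^ i"
      using that by (simp add: minus_one_power_iff)
    have 3: "(- a - of_nat i * 2 gchoose (k - i)) = (-1) ^ (k - i) * pochhammer (a + 2 * of_nat i) (k - i) / fact (k - i)"
      by (simp add: gbinomial_pochhammer algebra_simps)
    have "fps_hypergeo [a / 2, a / 2 + 1 / 2] [c] 1 $ i * 4 ^ i * ((-a - of_nat i * 2) gchoose (k - i))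
        = (pochhammer (a / 2) i * pochhammer (a / 2 + 1 / 2) i * 4 ^ i) * ((-a - of_nat i * 2) gchoose (k - i)) / (pochhammer c i * fact i)"
      by simp
    also have "\<dots> = (pochhammer a (2 * i) * pochhammer (a + 2 * of_nat i) (k - i)) * ((-1) ^ k * (-1) ^ i) / (pochhammer c i * fact i * fact (k - i))"
      unfolding 0 3 2 by (simp add: mult_ac)
    also have "\<dots> = (pochhammer a k * pochhammer (a + of_nat k) i) * ((-1) ^ k * (-1) ^ i) / (pochhammer c i * fact i * fact (k - i))"
      by (simp only: 1)
    also have "\<dots> = ((-1) ^ k * pochhammer a k / fact k) * (pochhammer (a + of_nat k) i * ((-1) ^ i * fact k / fact (k - i)) / (of_nat (fact i) * pochhammer c i))"
      unfolding divide_inverse of_nat_fact inverse_mult_distrib by (simp only: mult_ac) simp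
    finally show ?thesis
      using that by (simp only: pochhammer_neg_nat)
  qed
  then have "(fps_compose (fps_hypergeo [a / 2, a / 2 + 1 / 2] [c] 1) (fps_const 4 * fps_X * fps_binomial (-2)) * fps_binomial (-a)) $ k =
      (-1) ^ k * pochhammer a k / fact k *
      (\<Sum>i=0..k. pochhammer (a + of_nat k) i * pochhammer (- of_nat k) i / (of_nat (fact i) * pochhammer c i))"
    unfolding fps_compose_binomial_nth sum_distrib_left atMost_atLeast0 by (intro sum.cong) auto
  also have "\<dots> = (-1) ^ k * pochhammer a k / fact k * (pochhammer (c - (a + of_nat k)) k / pochhammer c k)"
    using c by (subst Vandermonde_pochhammer) auto
  \<comment> \<open>Reflection removes k from the base; the sign it produces cancels the (-1)^k in
    front.\<close>
  also have "pochhammer (c - (a + of_nat k)) k = (-1) ^ k * pochhammer (a - c + 1) k"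
    using pochhammer_minus'[of "c - a - 1" k] by (simp add: algebra_simps)
  also have "(-1) ^ k * pochhammer a k / fact k * ((-1) ^ k * pochhammer (a - c + 1) k / pochhammer c k) =
      fps_hypergeo [a, a - c + 1] [c] 1 $ k"
    by (cases "even k") (simp_all add: mult_ac)
  finally show "(fps_compose (fps_hypergeo [a / 2, a / 2 + 1 / 2] [c] 1) (fps_const 4 * fps_X * fps_binomial (-2)) * fps_binomial (-a)) $ k =
      fps_hypergeo [a, a - c + 1] [c] 1 $ k" .
qed

section \<open>The transformations as identities of functions near 0\<close>

text \<open>Both sides are first compared as functions of s, the variable of
  \<open>pfaff_fps\<close>; the substitution s = -t then gives the classical form.\<close>

lemma pfaff_near_0:
  assumes c: "c \<notin> \<int>\<^sub>\<le>\<^sub>0"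
  shows "\<forall>\<^sub>F t in nhds 0. (1 - t) powr (-a) * hyp2F1 a (c - b) c (t / (t - 1)) = hyp2F1 a b c t"
proof -
  let ?F = "fps_hypergeo [a, b] [c] 1"
  have "(\<lambda>s. s * (1 + s) powr (-1) :: complex) has_fps_expansion (fps_const 1 * fps_X * fps_binomial (-1))"
    using has_fps_expansion_mult[OF has_fps_expansion_fps_X has_fps_expansion_binomial_complex[of "-1"]] by simp
  then have "(\<lambda>s. (hyp2F1 a (c - b) c \<circ> (\<lambda>s. s * (1 + s) powr (-1))) s * (1 + s) powr (-a))
      has_fps_expansion fps_hypergeo [a, b] [c] (-1)"
    unfolding pfaff_fps[OF c, of a b, symmetric]
    by (intro has_fps_expansion_mult[OF has_fps_expansion_compose[OF has_fps_expansion_hyp2F1[OF c]]]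
          has_fps_expansion_binomial_complex) auto
  moreover have "(\<lambda>s. (hyp2F1 a b c \<circ> uminus) s) has_fps_expansion fps_hypergeo [a, b] [c] (-1)"
  proof -
    have "(\<lambda>s. - s :: complex) has_fps_expansion fps_const (-1) * fps_X"
      using has_fps_expansion_minus[OF has_fps_expansion_fps_X] by (simp flip: fps_const_neg)
    then have "(hyp2F1 a b c \<circ> uminus) has_fps_expansion fps_compose ?F (fps_const (-1) * fps_X)"
      by (intro has_fps_expansion_compose has_fps_expansion_hyp2F1[OF c]) auto
    also have "fps_compose ?F (fps_const (-1) * fps_X) = fps_hypergeo [a, b] [c] (-1)"
      unfolding fps_compose_linear by (rule fps_ext) simp
    finally show ?thesis by (simp add: o_def)
  qed
  ultimately have "\<forall>\<^sub>F s in nhds 0. (hyp2F1 a (c - b) c \<circ> (\<lambda>s. s * (1 + s) powr (-1))) s * (1 + s) powr (-a)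
      = (hyp2F1 a b c \<circ> uminus) s"
    by (rule has_fps_expansion_eqD)
  moreover have "filterlim uminus (nhds 0) (nhds (0 :: complex))"
    using tendsto_minus[OF filterlim_ident, of "0 :: complex"] by simp
  ultimately have "\<forall>\<^sub>F t in nhds 0. (hyp2F1 a (c - b) c \<circ> (\<lambda>s. s * (1 + s) powr (-1))) (-t) * (1 + (-t)) powr (-a)
      = (hyp2F1 a b c \<circ> uminus) (-t)"
    by (rule eventually_compose_filterlim)
  then show ?thesis
  proof eventually_elim
    case (elim t)
    \<comment> \<open>At t = 1 both sides are 0, by the conventions for \<open>powr\<close> at base
      0 and for division by 0.\<close>
    have "- t * (1 - t) powr (-1) = t / (t - 1)"
      by (cases "t = 1") (auto simp: powr_minus divide_simps algebra_simps)
    with elim show ?case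
      by (simp add: mult.commute)
  qed
qed

text \<open>Pfaff's transformation is used twice, with upper parameters (a, b) and (c - b, c - a).
  By symmetry both lead to F(a, c - b; c; t / (t - 1)), and the two powers of 1 - t differ by the
  exponent c - a - b.\<close>

lemma euler_near_0:
  assumes c: "c \<notin> \<int>\<^sub>\<le>\<^sub>0"
  shows "\<forall>\<^sub>F t in nhds 0. hyp2F1 a b c t = (1 - t) powr (c - a - b) * hyp2F1 (c - a) (c - b) c t"
  using pfaff_near_0[OF c, of a b] pfaff_near_0[OF c, of "c - b" "c - a"] t1_space_nhds[OF zero_neq_one]
proof eventually_elim
  case (elim t)
  have "(1 - t) powr (c - a - b) * (1 - t) powr (-(c - b)) = (1 - t) powr (-a)"
    using elim(3) by (simp flip: powr_add)
  then have "(1 - t) powr (-a) * hyp2F1 a (c - b) c (t / (t - 1)) =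
      (1 - t) powr (c - a - b) * ((1 - t) powr (-(c - b)) * hyp2F1 (c - b) (c - (c - a)) c (t / (t - 1)))"
    by (simp only: mult.assoc[symmetric] hyp2F1_commute[of "c - b"]) simp
  then show ?case
    using elim(1,2) by (simp add: hyp2F1_commute[of "c - b" "c - a"])
qed

lemma quadratic_near_0:
  assumes c: "c \<notin> \<int>\<^sub>\<le>\<^sub>0"
  shows "\<forall>\<^sub>F t in nhds 0. hyp2F1 (a / 2) (a / 2 + 1 / 2) c (4 * t / (1 + t)\<^sup>2) * (1 + t) powr (-a) =
           hyp2F1 a (a - c + 1) c t"
proof -
  have "(\<lambda>s. 4 * s * (1 + s) powr (-2) :: complex) has_fps_expansion (fps_const 4 * fps_X * fps_binomial (-2))"
    by (intro has_fps_expansion_mult has_fps_expansion_fps_X has_fps_expansion_binomial_complex has_fps_expansion_const)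
  then have "(\<lambda>s. (hyp2F1 (a / 2) (a / 2 + 1 / 2) c \<circ> (\<lambda>s. 4 * s * (1 + s) powr (-2))) s * (1 + s) powr (-a))
      has_fps_expansion fps_hypergeo [a, a - c + 1] [c] 1"
    unfolding quadratic_fps[OF c, of a, symmetric]
    by (intro has_fps_expansion_mult[OF has_fps_expansion_compose[OF has_fps_expansion_hyp2F1[OF c]]]
          has_fps_expansion_binomial_complex) auto
  note has_fps_expansion_eqD[OF this has_fps_expansion_hyp2F1[OF c]]
  moreover have "\<forall>\<^sub>F t in nhds (0 :: complex). t \<noteq> -1"
    by (rule t1_space_nhds) simp
  ultimately show ?thesis
  proof eventually_elim
    case (elim t)
    have "1 + t \<noteq> 0"
      using elim(2) by (simp add: add_eq_0_iff)
    then have "4 * t * (1 + t) powr (-2) = 4 * t / (1 + t)\<^sup>2"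
      by (simp add: powr_minus field_simps)
    with elim(1) show ?case by simp
  qed
qed

lemma Re_csqrt_pos:
  assumes "norm x < 1"
  shows "Re (csqrt (1 - x)) > 0"
proof -
  have "Re x < 1"
    using assms complex_Re_le_cmod[of x] by linarith
  then show ?thesis
    by (simp add: add_nonneg_pos)
qed

lemma csqrt_ratio_tendsto_0:
  "filterlim (\<lambda>x :: complex. (1 - csqrt (1 - x)) / (1 + csqrt (1 - x))) (nhds 0) (nhds 0)"
proof -
  define t where "t = (\<lambda>x :: complex. (1 - csqrt (1 - x)) / (1 + csqrt (1 - x)))"
  have "isCont t 0"
    unfolding t_def by (intro continuous_intros) auto
  then have "filterlim t (nhds (t 0)) (nhds 0)"
    by (simp add: isCont_def tendsto_at_iff_tendsto_nhds)
  then show ?thesis by (simp add: t_def)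
qed

lemma eventually_norm_less_1: "\<forall>\<^sub>F x in nhds (0 :: complex). norm x < 1"
  using eventually_nhds_in_open[of "ball (0 :: complex) 1" 0] by simp

text \<open>The relation x = 4 t / (1 + t)^2 is solved for the branch of t that tends to 0 with x,
  so that an identity valid for small t can be composed with it. On this branch 1 + t = 2 / (1 +
  r).\<close>

lemma quadratic_near_0_csqrt:
  assumes c: "c \<notin> \<int>\<^sub>\<le>\<^sub>0"
  shows "\<forall>\<^sub>F x in nhds 0. hyp2F1 (a / 2) (a / 2 + 1 / 2) c x =
     (2 / (1 + csqrt (1 - x))) powr a * hyp2F1 a (a - c + 1) c ((1 - csqrt (1 - x)) / (1 + csqrt (1 - x)))"
proof -
  define t where "t = (\<lambda>x :: complex. (1 - csqrt (1 - x)) / (1 + csqrt (1 - x)))"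
  have "filterlim t (nhds 0) (nhds 0)"
    unfolding t_def by (rule csqrt_ratio_tendsto_0)
  from eventually_compose_filterlim[OF quadratic_near_0[OF c] this]
  have "\<forall>\<^sub>F x in nhds 0. hyp2F1 (a / 2) (a / 2 + 1 / 2) c (4 * t x / (1 + t x)\<^sup>2) * (1 + t x) powr (-a) =
           hyp2F1 a (a - c + 1) c (t x)" .
  moreover note eventually_norm_less_1
  ultimately show ?thesis
  proof eventually_elim
    case (elim x)
    define r where "r = csqrt (1 - x)"
    have "Re r > 0"
      using Re_csqrt_pos[OF elim(2)] unfolding r_def .
    then have nz: "1 + r \<noteq> 0"
      by (auto simp: complex_eq_iff)
    have x: "x = 1 - r\<^sup>2"
      by (simp add: r_def)
    have t: "t x = (1 - r) / (1 + r)" "1 + t x = 2 / (1 + r)"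
      using nz by (simp_all add: t_def r_def divide_simps)
    \<comment> \<open>With w = 1 - r and u = 1 + r this is 4 t / (1 + t)^2 = 1 - r^2 = x.\<close>
    have "4 * (w / u) / (2 / u)\<^sup>2 = w * u" if "u \<noteq> 0" for u w :: complex
      using that by (simp add: power2_eq_square)
    from this[OF nz, of "1 - r"] have "4 * ((1 - r) / (1 + r)) / (2 / (1 + r))\<^sup>2 = 1 - r\<^sup>2"
      by (simp add: algebra_simps power2_eq_square)
    then have e: "4 * t x / (1 + t x)\<^sup>2 = x"
      unfolding t(2) unfolding t(1) x[symmetric] .
    from elim(1) have "hyp2F1 (a / 2) (a / 2 + 1 / 2) c x * (2 / (1 + r)) powr (-a) = hyp2F1 a (a - c + 1) c (t x)"
      unfolding e unfolding t(2) .
    then have "(2 / (1 + r)) powr a * hyp2F1 a (a - c + 1) c (t x) =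
        hyp2F1 (a / 2) (a / 2 + 1 / 2) c x * ((2 / (1 + r)) powr a * (2 / (1 + r)) powr (-a))"
      by (simp only: mult_ac)
    also have "(2 / (1 + r)) powr a * (2 / (1 + r)) powr (-a) = 1"
      using nz by (simp flip: powr_add)
    finally show ?case
      unfolding r_def[symmetric] t(1)[symmetric] by simp
  qed
qed

section \<open>The terminating series and continuation to the unit disc\<close>

text \<open>For t other than 1 and -1 this is (1 - t)^m times the Jacobi polynomial with parameters
  \<alpha>, -\<alpha> at (1 + t) / (1 - t). Unlike the hypergeometric form, it has no denominators
  depending on \<alpha>.\<close>

definition jacobi_sum :: "nat \<Rightarrow> complex \<Rightarrow> complex \<Rightarrow> complex" where
  "jacobi_sum m \<alpha> t =
     (\<Sum>k\<le>m. ((of_nat m + \<alpha>) gchoose (m - k)) * ((of_nat m - \<alpha>) gchoose k) * t ^ k)"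

lemma hyp2F1_terminating:
  "hyp2F1 a (- of_nat m) c t =
     (\<Sum>k\<le>m. pochhammer a k * pochhammer (- of_nat m) k / (pochhammer c k * fact k) * t ^ k)"
  unfolding hyp2F1_def eval_fps_def
  by (subst suminf_finite[where N = "{..m}"]) (auto simp: pochhammer_of_nat_eq_0_iff)

text \<open>Termwise: splitting (\<alpha> + 1)_m at k cancels the denominator (\<alpha> + 1)_k and
  leaves the first binomial, while (\<alpha> - m)_k gives the second. The sign (-1)^k of the latter
  matches that of (-m)_k.\<close>

lemma jacobi_sum_eq_hyp2F1:
  assumes c: "\<alpha> + 1 \<notin> \<int>\<^sub>\<le>\<^sub>0"
  shows "jacobi_sum m \<alpha> t =
           pochhammer (\<alpha> + 1) m / fact m * hyp2F1 (\<alpha> - of_nat m) (- of_nat m) (\<alpha> + 1) t"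
  unfolding jacobi_sum_def hyp2F1_terminating sum_distrib_left
proof (intro sum.cong refl)
  fix k
  assume "k \<in> {..m}"
  then have k: "k \<le> m" by simp
  have 1: "pochhammer (\<alpha> + 1) m = pochhammer (\<alpha> + 1) k * pochhammer (\<alpha> + 1 + of_nat k) (m - k)"
    using k by (rule pochhammer_product)
  have 2: "(of_nat m + \<alpha>) gchoose (m - k) = pochhammer (\<alpha> + 1 + of_nat k) (m - k) / fact (m - k)"
    using k by (simp add: gbinomial_pochhammer' of_nat_diff algebra_simps)
  have 3: "(of_nat m - \<alpha>) gchoose k = (-1) ^ k * pochhammer (\<alpha> - of_nat m) k / fact k"
    by (simp add: gbinomial_pochhammer)
  show "((of_nat m + \<alpha>) gchoose (m - k)) * ((of_nat m - \<alpha>) gchoose k) * t ^ k =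
      pochhammer (\<alpha> + 1) m / fact m *
        (pochhammer (\<alpha> - of_nat m) k * pochhammer (- of_nat m) k / (pochhammer (\<alpha> + 1) k * fact k) * t ^ k)"
    unfolding 1 2 3 pochhammer_neg_nat[OF k]
    using pochhammer_nonzero[OF c, of k] by (simp add: divide_simps)
qed

lemma holomorphic_csqrt_one_minus: "(\<lambda>x. csqrt (1 - x)) holomorphic_on ball 0 1"
proof (intro holomorphic_intros)
  fix x :: complex
  assume "x \<in> ball 0 1"
  then have "Re x < 1"
    using complex_Re_le_cmod[of x] by simp
  then show "1 - x \<notin> \<real>\<^sub>\<le>\<^sub>0"
    by (simp add: complex_nonpos_Reals_iff)
qed

text \<open>Since 1 + r lies in the right half plane, so does 2 / (1 + r); the principal power of it
  is therefore holomorphic.\<close>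

lemma two_div_one_plus_off_cut:
  assumes "Re r > 0"
  shows "2 / (1 + r) \<notin> \<real>\<^sub>\<le>\<^sub>0" "1 + r \<noteq> 0" "r \<noteq> 0"
proof -
  show nz: "1 + r \<noteq> 0" "r \<noteq> 0"
    using assms by (auto simp: complex_eq_iff)
  have "Re (2 / (1 + r)) = 2 * (1 + Re r) / (norm (1 + r))\<^sup>2"
    by (simp add: Re_divide cmod_power2)
  also have "\<dots> > 0"
    using assms nz by (intro divide_pos_pos) auto
  finally show "2 / (1 + r) \<notin> \<real>\<^sub>\<le>\<^sub>0"
    by (auto simp: complex_nonpos_Reals_iff)
qed

lemma holomorphic_jacobi_sum [holomorphic_intros]:
  "f holomorphic_on A \<Longrightarrow> (\<lambda>x. jacobi_sum m \<alpha> (f x)) holomorphic_on A"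
  unfolding jacobi_sum_def by (intro holomorphic_intros)

text \<open>The difference of the two sides is holomorphic on the disc with zero Taylor series at 0,
  so it vanishes on the whole disc.\<close>

lemma hyp2F1_eq_on_disc:
  assumes c: "c \<notin> \<int>\<^sub>\<le>\<^sub>0" and g: "g holomorphic_on ball 0 1"
    and eq: "\<forall>\<^sub>F x in nhds 0. hyp2F1 a b c x = g x" and x: "norm x < 1"
  shows "hyp2F1 a b c x = g x"
proof -
  have "(\<lambda>x. hyp2F1 a b c x - g x) has_fps_expansion 0"
    unfolding has_fps_expansion_0_iff using eq by eventually_elim simp
  then have "hyp2F1 a b c x - g x = 0"
    by (rule has_fps_expansion_0_analytic_continuation[where A = "ball 0 1"])
       (use x in \<open>auto intro!: holomorphic_intros holomorphic_hyp2F1[OF c] g\<close>)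
  then show ?thesis by simp
qed

text \<open>With c = \<alpha> + 1 and a = \<alpha> - m, the parameter a - c + 1 is exactly -m, so
  the quadratic transformation alone produces a terminating series.\<close>

lemma hyp2F1_quadratic_minus:
  fixes \<alpha> x :: complex and m :: nat
  assumes c: "\<alpha> + 1 \<notin> \<int>\<^sub>\<le>\<^sub>0" and x: "norm x < 1"
  defines "r \<equiv> csqrt (1 - x)"
  shows "pochhammer (\<alpha> + 1) m / fact m *
           hyp2F1 ((\<alpha> - of_nat m) / 2) ((\<alpha> - of_nat m) / 2 + 1 / 2) (\<alpha> + 1) x =
         (2 / (1 + r)) powr (\<alpha> - of_nat m) * jacobi_sum m \<alpha> ((1 - r) / (1 + r))"
proof -
  let ?C = "pochhammer (\<alpha> + 1) m / fact m"
  let ?r = "\<lambda>x. csqrt (1 - x)"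
  define g where "g = (\<lambda>x. (2 / (1 + ?r x)) powr (\<alpha> - of_nat m) *
      (jacobi_sum m \<alpha> ((1 - ?r x) / (1 + ?r x)) / ?C))"
  have C: "?C \<noteq> 0"
    using pochhammer_nonzero[OF c] by simp
  have r: "Re (?r x) > 0" if "x \<in> ball 0 1" for x
    using that by (intro Re_csqrt_pos) simp
  have "g holomorphic_on ball 0 1"
    unfolding g_def using C two_div_one_plus_off_cut[OF r]
    by (intro holomorphic_csqrt_one_minus holomorphic_intros) auto
  moreover have "\<forall>\<^sub>F x in nhds 0. hyp2F1 ((\<alpha> - of_nat m) / 2) ((\<alpha> - of_nat m) / 2 + 1 / 2) (\<alpha> + 1) x = g x"
    using quadratic_near_0_csqrt[OF c, of "\<alpha> - of_nat m"]
  proof eventually_elim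
    case (elim x)
    have "\<alpha> - of_nat m - (\<alpha> + 1) + 1 = - of_nat m"
      by simp
    moreover have "jacobi_sum m \<alpha> t / ?C = hyp2F1 (\<alpha> - of_nat m) (- of_nat m) (\<alpha> + 1) t" for t
      using C unfolding jacobi_sum_eq_hyp2F1[OF c] by simp
    ultimately show ?case
      using elim by (simp only: g_def)
  qed
  ultimately have "hyp2F1 ((\<alpha> - of_nat m) / 2) ((\<alpha> - of_nat m) / 2 + 1 / 2) (\<alpha> + 1) x = g x"
    using x by (intro hyp2F1_eq_on_disc[OF c])
  then show ?thesis
    unfolding g_def r_def using C by simp
qed

text \<open>Here a - c + 1 = m + 1. Euler's transformation replaces the upper parameters \<alpha> +
  m + 1 and m + 1 by -m and \<alpha> - m, at the cost of the factor (1 - t)^(-(2m+1)) with 1 - t = 2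
  r / (1 + r).\<close>

lemma hyp2F1_quadratic_plus:
  fixes \<alpha> x :: complex and m :: nat
  assumes c: "\<alpha> + 1 \<notin> \<int>\<^sub>\<le>\<^sub>0" and x: "norm x < 1"
  defines "r \<equiv> csqrt (1 - x)"
  shows "pochhammer (\<alpha> + 1) m / fact m *
           hyp2F1 ((\<alpha> + of_nat m + 1) / 2) ((\<alpha> + of_nat m + 1) / 2 + 1 / 2) (\<alpha> + 1) x =
         (2 / (1 + r)) powr (\<alpha> + of_nat m + 1) * ((1 + r) / (2 * r)) ^ (2 * m + 1) *
           jacobi_sum m \<alpha> ((1 - r) / (1 + r))"
proof -
  let ?C = "pochhammer (\<alpha> + 1) m / fact m"
  let ?r = "\<lambda>x. csqrt (1 - x)"
  define t where "t = (\<lambda>x. (1 - ?r x) / (1 + ?r x))"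
  define g where "g = (\<lambda>x. (2 / (1 + ?r x)) powr (\<alpha> + of_nat m + 1) * ((1 + ?r x) / (2 * ?r x)) ^ (2 * m + 1) *
      (jacobi_sum m \<alpha> (t x) / ?C))"
  have C: "?C \<noteq> 0"
    using pochhammer_nonzero[OF c] by simp
  have r: "Re (?r x) > 0" if "x \<in> ball 0 1" for x
    using that by (intro Re_csqrt_pos) simp
  have "g holomorphic_on ball 0 1"
    unfolding g_def t_def
  proof (intro holomorphic_csqrt_one_minus holomorphic_intros)
    fix x :: complex
    assume x: "x \<in> ball 0 1"
    show "2 / (1 + ?r x) \<notin> \<real>\<^sub>\<le>\<^sub>0" "1 + ?r x \<noteq> 0" "1 + ?r x \<noteq> 0" "2 * ?r x \<noteq> 0" "?C \<noteq> 0"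
      using two_div_one_plus_off_cut[OF r[OF x]] C by auto
  qed
  moreover have "\<forall>\<^sub>F x in nhds 0. hyp2F1 ((\<alpha> + of_nat m + 1) / 2) ((\<alpha> + of_nat m + 1) / 2 + 1 / 2) (\<alpha> + 1) x = g x"
  proof -
    have "filterlim t (nhds 0) (nhds 0)"
      unfolding t_def by (rule csqrt_ratio_tendsto_0)
    from eventually_compose_filterlim[OF euler_near_0[OF c, of "\<alpha> + of_nat m + 1" "of_nat m + 1"] this]
      quadratic_near_0_csqrt[OF c, of "\<alpha> + of_nat m + 1"]
      eventually_norm_less_1
    show ?thesis
    proof eventually_elim
      case (elim x)
      have nz: "?r x \<noteq> 0" "1 + ?r x \<noteq> 0"
        using two_div_one_plus_off_cut[OF r] elim(3) by auto
      have e: "\<alpha> + of_nat m + 1 - (\<alpha> + 1) + 1 = of_nat m + 1"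
        "\<alpha> + 1 - (\<alpha> + of_nat m + 1) - (of_nat m + 1) = - of_nat (2 * m + 1)"
        "\<alpha> + 1 - (\<alpha> + of_nat m + 1) = - of_nat m" "\<alpha> + 1 - (of_nat m + 1) = \<alpha> - of_nat m"
        by simp_all
      have t: "1 - t x = 2 * ?r x / (1 + ?r x)"
        using nz by (simp add: t_def field_simps)
      \<comment> \<open>The exponent is a negative integer, so the principal power is an ordinary
        inverse power, holomorphic as long as r is nonzero.\<close>
      have "(1 - t x) powr (- of_nat (2 * m + 1)) = inverse ((1 - t x) ^ (2 * m + 1))"
        using nz unfolding powr_minus t by (subst powr_nat') auto
      also have "\<dots> = ((1 + ?r x) / (2 * ?r x)) ^ (2 * m + 1)"
        unfolding t power_inverse[symmetric] by simp
      finally have p: "(1 - t x) powr (- of_nat (2 * m + 1)) = ((1 + ?r x) / (2 * ?r x)) ^ (2 * m + 1)" .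
      have h: "jacobi_sum m \<alpha> (t x) / ?C = hyp2F1 (- of_nat m) (\<alpha> - of_nat m) (\<alpha> + 1) (t x)"
        using C unfolding jacobi_sum_eq_hyp2F1[OF c] by (simp add: hyp2F1_commute)
      from elim(1) have "hyp2F1 (\<alpha> + of_nat m + 1) (of_nat m + 1) (\<alpha> + 1) (t x) =
          ((1 + ?r x) / (2 * ?r x)) ^ (2 * m + 1) * hyp2F1 (- of_nat m) (\<alpha> - of_nat m) (\<alpha> + 1) (t x)"
        unfolding e(2) unfolding e(3,4) p .
      moreover from elim(2) have "hyp2F1 ((\<alpha> + of_nat m + 1) / 2) ((\<alpha> + of_nat m + 1) / 2 + 1 / 2) (\<alpha> + 1) x =
          (2 / (1 + ?r x)) powr (\<alpha> + of_nat m + 1) * hyp2F1 (\<alpha> + of_nat m + 1) (of_nat m + 1) (\<alpha> + 1) (t x)"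
        unfolding e(1) t_def .
      ultimately show ?case
        unfolding g_def h by (simp only: mult.assoc)
    qed
  qed
  ultimately have "hyp2F1 ((\<alpha> + of_nat m + 1) / 2) ((\<alpha> + of_nat m + 1) / 2 + 1 / 2) (\<alpha> + 1) x = g x"
    using x by (intro hyp2F1_eq_on_disc[OF c])
  then show ?thesis
    unfolding g_def r_def t_def using C by simp
qed

section \<open>The explicit sum for the Jacobi polynomial\<close>

text \<open>The slopes s = -1 and s = 1 serve the two factors in Rodrigues' formula. The falling
  factorial of a is written as k! times a binomial so that the final coefficients appear
  directly.\<close>

lemma higher_deriv_powr_linear:
  fixes a s :: complex
  assumes "1 + s * z \<notin> \<real>\<^sub>\<le>\<^sub>0"
  shows "(deriv ^^ k) (\<lambda>w. (1 + s * w) powr a) z =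
           s ^ k * (fact k * (a gchoose k)) * (1 + s * z) powr (a - of_nat k)"
  using assms
proof (induction k arbitrary: z)
  case 0
  then show ?case by simp
next
  case (Suc k)
  \<comment> \<open>Differentiating the induction hypothesis requires it on a neighbourhood of z,
    which the openness of the slit domain provides.\<close>
  have "open ((\<lambda>w. 1 + s * w) -` (- \<real>\<^sub>\<le>\<^sub>0))"
    by (intro open_vimage open_Compl closed_nonpos_Reals_complex continuous_intros)
  then have "\<forall>\<^sub>F w in nhds z. 1 + s * w \<notin> \<real>\<^sub>\<le>\<^sub>0"
    using eventually_nhds_in_open[of "(\<lambda>w. 1 + s * w) -` (- \<real>\<^sub>\<le>\<^sub>0)" z] Suc.prems by simp
  then have "\<forall>\<^sub>F w in nhds z. (deriv ^^ k) (\<lambda>w. (1 + s * w) powr a) w =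
      s ^ k * (fact k * (a gchoose k)) * (1 + s * w) powr (a - of_nat k)"
    by eventually_elim (rule Suc.IH)
  then have "deriv ((deriv ^^ k) (\<lambda>w. (1 + s * w) powr a)) z =
      deriv (\<lambda>w. s ^ k * (fact k * (a gchoose k)) * (1 + s * w) powr (a - of_nat k)) z"
    by (rule deriv_cong_ev) simp
  also have "\<dots> = s ^ k * (fact k * (a gchoose k)) * ((a - of_nat k) * (1 + s * z) powr (a - of_nat k - 1) * s)"
    using Suc.prems by (intro DERIV_imp_deriv) (auto intro!: derivative_eq_intros)
  also have "\<dots> = s ^ Suc k * (fact k * (a gchoose k) * (a - of_nat k)) * (1 + s * z) powr (a - of_nat (Suc k))"
    by (simp add: algebra_simps)
  also have "fact k * (a gchoose k) * (a - of_nat k) = fact (Suc k) * (a gchoose Suc k)"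
    by (simp only: gbinomial_mult_fact prod.atLeast0_lessThan_Suc)
  finally show ?case by simp
qed

text \<open>In each Leibniz term the outer powers reduce the exponents to the natural numbers n - i
  and i, and the factorials from the derivatives combine with n choose i to n!.\<close>

lemma rodrigues_eq_sum:
  assumes z: "1 - z \<notin> \<real>\<^sub>\<le>\<^sub>0" "1 + z \<notin> \<real>\<^sub>\<le>\<^sub>0"
  shows "rodrigues n \<alpha> \<beta> z = (\<Sum>k\<le>n. ((of_nat n + \<alpha>) gchoose (n - k)) * ((of_nat n + \<beta>) gchoose k) *
           ((z - 1) / 2) ^ k * ((z + 1) / 2) ^ (n - k))"
proof -
  define S where "S = {z::complex. 1 - z \<notin> \<real>\<^sub>\<le>\<^sub>0 \<and> 1 + z \<notin> \<real>\<^sub>\<le>\<^sub>0}"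
  let ?A = "\<lambda>w. (1 - w) powr (\<alpha> + of_nat n)" and ?B = "\<lambda>w. (1 + w) powr (\<beta> + of_nat n)"
  have nz: "1 - z \<noteq> 0" "1 + z \<noteq> 0" using z by auto
  have A: "(deriv ^^ i) ?A z = (-1) ^ i * (fact i * ((of_nat n + \<alpha>) gchoose i)) * (1 - z) powr (\<alpha> + of_nat n - of_nat i)" for i
    using higher_deriv_powr_linear[of "-1" z i "\<alpha> + of_nat n"] z by (simp add: add.commute)
  have B: "(deriv ^^ i) ?B z = fact i * ((of_nat n + \<beta>) gchoose i) * (1 + z) powr (\<beta> + of_nat n - of_nat i)" for i
    using higher_deriv_powr_linear[of 1 z i "\<beta> + of_nat n"] z by (simp add: add.commute)
  have "(deriv ^^ n) (\<lambda>w. ?A w * ?B w) z =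
      (\<Sum>i=0..n. of_nat (n choose i) * (deriv ^^ i) ?A z * (deriv ^^ (n - i)) ?B z)"
    by (rule higher_deriv_mult[where S = S])
       (use z open_off_cuts in \<open>auto simp: S_def intro!: holomorphic_intros\<close>)
  then have "rodrigues n \<alpha> \<beta> z = (\<Sum>i=0..n. (-1)^n / (2^n * fact n) * (1 - z) powr (-\<alpha>) * (1 + z) powr (-\<beta>) *
      (of_nat (n choose i) * (deriv ^^ i) ?A z * (deriv ^^ (n - i)) ?B z))"
    unfolding rodrigues_def by (simp only: sum_distrib_left)
  also have "\<dots> = (\<Sum>i=0..n. ((of_nat n + \<alpha>) gchoose i) * ((of_nat n + \<beta>) gchoose (n - i)) *
           ((z - 1) / 2) ^ (n - i) * ((z + 1) / 2) ^ i)"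
  proof (intro sum.cong refl)
    fix i
    assume "i \<in> {0..n}"
    then have i: "i \<le> n" by simp
    have 1: "(1 - z) powr (-\<alpha>) * (1 - z) powr (\<alpha> + of_nat n - of_nat i) = (1 - z) ^ (n - i)"
    proof -
      have "(1 - z) powr (-\<alpha>) * (1 - z) powr (\<alpha> + of_nat n - of_nat i) = (1 - z) powr of_nat (n - i)"
        using i by (simp add: of_nat_diff flip: powr_add)
      then show ?thesis using nz by (simp add: powr_nat')
    qed
    have 2: "(1 + z) powr (-\<beta>) * (1 + z) powr (\<beta> + of_nat n - of_nat (n - i)) = (1 + z) ^ i"
    proof -
      have "(1 + z) powr (-\<beta>) * (1 + z) powr (\<beta> + of_nat n - of_nat (n - i)) = (1 + z) powr of_nat i"
        using i by (simp add: of_nat_diff flip: powr_add)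
      then show ?thesis using nz by (simp add: powr_nat')
    qed
    have 3: "of_nat (n choose i) * fact i * fact (n - i) = (fact n :: complex)"
    proof -
      have "of_nat (fact i * fact (n - i) * (n choose i)) = (of_nat (fact n) :: complex)"
        by (simp only: binomial_fact_lemma[OF i])
      then show ?thesis by (simp add: mult_ac)
    qed
    have 4: "(1 - z) ^ (n - i) = (-1) ^ (n - i) * (z - 1) ^ (n - i)"
    proof -
      have "1 - z = (-1) * (z - 1)" by simp
      then show ?thesis by (simp only: power_mult_distrib)
    qed
    \<comment> \<open>The three signs come from Rodrigues' prefactor, from differentiating 1 - w,
      and from writing 1 - z as -(z - 1).\<close>
    have 5: "(-1) ^ n * (-1) ^ i * (-1) ^ (n - i) = (1 :: complex)"
    proof -
      have "(-1) ^ i * (-1) ^ (n - i) = (-1 :: complex) ^ n"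
        using i by (simp flip: power_add)
      then show ?thesis by (cases "even n") (simp_all add: mult.assoc)
    qed
    have 6: "(2 :: complex) ^ n = 2 ^ i * 2 ^ (n - i)"
      using i by (simp flip: power_add)
    have "(-1)^n / (2^n * fact n) * (1 - z) powr (-\<alpha>) * (1 + z) powr (-\<beta>) *
      (of_nat (n choose i) * (deriv ^^ i) ?A z * (deriv ^^ (n - i)) ?B z) =
      ((-1) ^ n * (-1) ^ i) / (2 ^ n * fact n) * (of_nat (n choose i) * fact i * fact (n - i)) *
      (((of_nat n + \<alpha>) gchoose i) * ((of_nat n + \<beta>) gchoose (n - i))) *
      ((1 - z) powr (-\<alpha>) * (1 - z) powr (\<alpha> + of_nat n - of_nat i)) *
      ((1 + z) powr (-\<beta>) * (1 + z) powr (\<beta> + of_nat n - of_nat (n - i)))"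
      unfolding A B divide_inverse by (simp only: mult_ac)
    also have "\<dots> = ((-1) ^ n * (-1) ^ i * (-1) ^ (n - i)) / (2 ^ i * 2 ^ (n - i)) *
      (((of_nat n + \<alpha>) gchoose i) * ((of_nat n + \<beta>) gchoose (n - i))) * ((z - 1) ^ (n - i) * (1 + z) ^ i)"
      unfolding 1 2 3 4 6 by simp
    also have "\<dots> = ((of_nat n + \<alpha>) gchoose i) * ((of_nat n + \<beta>) gchoose (n - i)) *
           ((z - 1) / 2) ^ (n - i) * ((z + 1) / 2) ^ i"
      unfolding 5 by (simp add: power_divide add.commute mult_ac)
    finally show "(-1)^n / (2^n * fact n) * (1 - z) powr (-\<alpha>) * (1 + z) powr (-\<beta>) *
      (of_nat (n choose i) * (deriv ^^ i) ?A z * (deriv ^^ (n - i)) ?B z) = \<dots>" .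
  qed
  also have "\<dots> = (\<Sum>k\<le>n. ((of_nat n + \<alpha>) gchoose (n - k)) * ((of_nat n + \<beta>) gchoose k) *
           ((z - 1) / 2) ^ k * ((z + 1) / 2) ^ (n - k))"
    by (rule sum.reindex_bij_witness[of _ "\<lambda>k. n - k" "\<lambda>k. n - k"]) auto
  finally show ?thesis .
qed

text \<open>Rodrigues' formula is available only off the cuts, but there it determines the
  polynomial uniquely. The sum therefore holds at every z, in particular at coth \<xi>, which lies
  on a cut.\<close>

lemma poly_jacobi_poly_eq_sum:
  "poly (jacobi_poly n \<alpha> \<beta>) z = (\<Sum>k\<le>n. ((of_nat n + \<alpha>) gchoose (n - k)) * ((of_nat n + \<beta>) gchoose k) *
           ((z - 1) / 2) ^ k * ((z + 1) / 2) ^ (n - k))"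
proof -
  define p where "p = (\<Sum>k\<le>n. smult (((of_nat n + \<alpha>) gchoose (n - k)) * ((of_nat n + \<beta>) gchoose k))
           ([:-1/2, 1/2:] ^ k * [:1/2, 1/2:] ^ (n - k)))"
  have p: "poly p z = (\<Sum>k\<le>n. ((of_nat n + \<alpha>) gchoose (n - k)) * ((of_nat n + \<beta>) gchoose k) *
           ((z - 1) / 2) ^ k * ((z + 1) / 2) ^ (n - k))" for z
  proof -
    have "poly [:-1/2, 1/2:] z = (z - 1) / 2" "poly [:1/2, 1/2:] z = (z + 1) / 2"
      by (simp_all add: field_simps)
    then show ?thesis
      unfolding p_def poly_sum by (simp only: poly_smult poly_mult poly_power mult.assoc)
  qed
  have "jacobi_poly n \<alpha> \<beta> = p"
    unfolding jacobi_poly_def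
    by (rule the1_equality[OF jacobi_poly_ex1]) (simp add: p rodrigues_eq_sum)
  then show ?thesis by (simp only: p)
qed

text \<open>At z = 1 / r the factor (z + 1) / 2 is (1 + r) / (2 r), and (z - 1) / 2 is the same
  times t; m such factors come out of every term.\<close>

lemma jacobi_poly_eq_jacobi_sum:
  assumes "r \<noteq> 0" "1 + r \<noteq> 0"
  shows "poly (jacobi_poly m \<alpha> (-\<alpha>)) (1 / r) = ((1 + r) / (2 * r)) ^ m * jacobi_sum m \<alpha> ((1 - r) / (1 + r))"
  unfolding poly_jacobi_poly_eq_sum jacobi_sum_def sum_distrib_left
proof (intro sum.cong refl)
  fix k
  assume "k \<in> {..m}"
  then have k: "m = k + (m - k)" by simp
  have 1: "(1 / r - 1) / 2 = (1 + r) / (2 * r) * ((1 - r) / (1 + r))" "(1 / r + 1) / 2 = (1 + r) / (2 * r)"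
    using assms by (simp_all add: divide_simps)
  have 3: "of_nat m + - \<alpha> = of_nat m - \<alpha>"
    by simp
  have 2: "((1 + r) / (2 * r)) ^ m = ((1 + r) / (2 * r)) ^ k * ((1 + r) / (2 * r)) ^ (m - k)"
    by (subst k) (rule power_add)
  show "((of_nat m + \<alpha>) gchoose (m - k)) * ((of_nat m + - \<alpha>) gchoose k) * ((1 / r - 1) / 2) ^ k *
          ((1 / r + 1) / 2) ^ (m - k) =
        ((1 + r) / (2 * r)) ^ m *
        (((of_nat m + \<alpha>) gchoose (m - k)) * ((of_nat m - \<alpha>) gchoose k) * ((1 - r) / (1 + r)) ^ k)"
    unfolding 1 2 3 power_mult_distrib by (simp only: mult_ac)
qed

section \<open>The hypergeometric factors in terms of Jacobi polynomials\<close>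

text \<open>The power (2 / (1 + r))^(-m) equals r^m ((1 + r) / (2 r))^m, whose second factor is the
  one converting \<open>jacobi_sum\<close> into the Jacobi polynomial.\<close>

lemma hyp2F1_jacobi_minus:
  assumes c: "\<alpha> + 1 \<notin> \<int>\<^sub>\<le>\<^sub>0" and x: "norm x < 1"
  defines "r \<equiv> csqrt (1 - x)"
  shows "pochhammer (\<alpha> + 1) m *
           hyp2F1 ((\<alpha> - of_nat m) / 2) ((\<alpha> - of_nat m) / 2 + 1 / 2) (\<alpha> + 1) x =
         fact m * (2 / (1 + r)) powr \<alpha> * r ^ m * poly (jacobi_poly m \<alpha> (-\<alpha>)) (1 / r)"
proof -
  have r: "r \<noteq> 0" "1 + r \<noteq> 0"
    unfolding r_def using two_div_one_plus_off_cut[OF Re_csqrt_pos[OF x]] by auto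
  have "(2 / (1 + r)) powr (\<alpha> - of_nat m) = (2 / (1 + r)) powr \<alpha> / (2 / (1 + r)) ^ m"
    using r by (simp add: powr_diff powr_nat')
  also have "\<dots> = (2 / (1 + r)) powr \<alpha> * (r ^ m * ((1 + r) / (2 * r)) ^ m)"
    using r by (simp add: power_divide power_mult_distrib)
  finally have "(2 / (1 + r)) powr (\<alpha> - of_nat m) = (2 / (1 + r)) powr \<alpha> * (r ^ m * ((1 + r) / (2 * r)) ^ m)" .
  then show ?thesis
    using hyp2F1_quadratic_minus[OF c x, of m] jacobi_poly_eq_jacobi_sum[OF r, of m \<alpha>]
    unfolding r_def[symmetric] by (simp add: divide_eq_eq mult_ac)
qed

lemma hyp2F1_jacobi_plus:
  assumes c: "\<alpha> + 1 \<notin> \<int>\<^sub>\<le>\<^sub>0" and x: "norm x < 1"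
  defines "r \<equiv> csqrt (1 - x)"
  shows "pochhammer (\<alpha> + 1) m *
           hyp2F1 ((\<alpha> + of_nat m + 1) / 2) ((\<alpha> + of_nat m + 1) / 2 + 1 / 2) (\<alpha> + 1) x =
         fact m * (2 / (1 + r)) powr \<alpha> * (1 / r) ^ (m + 1) * poly (jacobi_poly m \<alpha> (-\<alpha>)) (1 / r)"
proof -
  have r: "r \<noteq> 0" "1 + r \<noteq> 0"
    unfolding r_def using two_div_one_plus_off_cut[OF Re_csqrt_pos[OF x]] by auto
  have "(2 / (1 + r)) powr (\<alpha> + of_nat m + 1) = (2 / (1 + r)) powr (\<alpha> + of_nat (m + 1))"
    by (simp add: add_ac)
  also have "\<dots> = (2 / (1 + r)) powr \<alpha> * (2 / (1 + r)) ^ (m + 1)"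
    using r by (subst powr_add) (simp only: powr_nat' divide_eq_0_iff zero_neq_numeral[symmetric] simp_thms)
  finally have p: "(2 / (1 + r)) powr (\<alpha> + of_nat m + 1) = (2 / (1 + r)) powr \<alpha> * (2 / (1 + r)) ^ (m + 1)" .
  \<comment> \<open>Of the 2 m + 1 factors, m + 1 combine with (2 / (1 + r))^(m+1) to r^(-(m+1));
    the other m belong to the Jacobi polynomial.\<close>
  have "2 * m + 1 = (m + 1) + m"
    by simp
  then have "((1 + r) / (2 * r)) ^ (2 * m + 1) = ((1 + r) / (2 * r)) ^ (m + 1) * ((1 + r) / (2 * r)) ^ m"
    by (simp only: power_add)
  then have "(2 / (1 + r)) powr (\<alpha> + of_nat m + 1) * ((1 + r) / (2 * r)) ^ (2 * m + 1) =
      (2 / (1 + r)) powr \<alpha> * ((2 / (1 + r)) ^ (m + 1) * ((1 + r) / (2 * r)) ^ (m + 1)) * ((1 + r) / (2 * r)) ^ m"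
    unfolding p by (simp only: mult.assoc)
  also have "(2 / (1 + r)) ^ (m + 1) * ((1 + r) / (2 * r)) ^ (m + 1) = (1 / r) ^ (m + 1)"
  proof -
    have "2 / u * (u / (2 * r)) = 1 / r" if "u \<noteq> 0" for u
      using that by simp
    from this[OF r(2)] show ?thesis
      by (simp only: power_mult_distrib[symmetric])
  qed
  finally have e: "(2 / (1 + r)) powr (\<alpha> + of_nat m + 1) * ((1 + r) / (2 * r)) ^ (2 * m + 1) =
      (2 / (1 + r)) powr \<alpha> * (1 / r) ^ (m + 1) * ((1 + r) / (2 * r)) ^ m" .
  have "pochhammer (\<alpha> + 1) m / fact m *
           hyp2F1 ((\<alpha> + of_nat m + 1) / 2) ((\<alpha> + of_nat m + 1) / 2 + 1 / 2) (\<alpha> + 1) x =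
      (2 / (1 + r)) powr \<alpha> * (1 / r) ^ (m + 1) * poly (jacobi_poly m \<alpha> (-\<alpha>)) (1 / r)"
    using hyp2F1_quadratic_plus[OF c x, of m]
    unfolding r_def[symmetric] e jacobi_poly_eq_jacobi_sum[OF r] by (simp only: mult.assoc)
  then show ?thesis
    by (simp add: divide_eq_eq mult_ac)
qed

section \<open>The Legendre function at generic degree\<close>

lemma powr_of_real_pos:
  fixes c :: complex
  assumes "x > 0"
  shows "of_real x powr c = exp (c * of_real (ln x))"
  using assms by (simp add: powr_def Ln_of_real)

text \<open>Makes the coefficients of the Jacobi polynomial continuous in \<alpha>, for the limit at
  exceptional degrees.\<close>

lemma isCont_gbinomial [continuous_intros]:
  fixes f :: "'a :: t2_space \<Rightarrow> 'b :: real_normed_field"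
  assumes "isCont f x"
  shows "isCont (\<lambda>x. f x gchoose k) x"
  unfolding gbinomial_prod_rev using assms by (intro continuous_intros) auto

text \<open>The right-hand side shared by both signs. The argument \<alpha> comes last because
  continuity is taken in it.\<close>

definition Qhat_core :: "nat \<Rightarrow> real \<Rightarrow> complex \<Rightarrow> complex" where
  "Qhat_core m z \<alpha> = of_real (sqrt (pi/2)) * fact m
          * of_real ((z^2 - 1) powr (-1/4))
          * of_real (z + sqrt (z^2 - 1)) powr (-\<alpha>)
          * poly (jacobi_poly m \<alpha> (-\<alpha>)) (of_real (z / sqrt (z^2 - 1)))"

text \<open>For z = cosh \<xi> these are s = sinh \<xi>, w = exp \<xi> and r = tanh \<xi>.\<close>

context
  fixes z s w r :: real and x :: complex
  assumes z: "z > 1"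
  defines "s \<equiv> sqrt (z^2 - 1)" and "w \<equiv> z + sqrt (z^2 - 1)" and "x \<equiv> of_real (1 / z^2)"
    and "r \<equiv> s / z"
begin

lemma legendre_arg_pos: "z > 0" "s > 0" "w > 0" "z^2 - 1 > 0" "s^2 = z^2 - 1"
proof -
  show "z > 0" using z by simp
  show 1: "z^2 - 1 > 0" using z by (simp add: one_less_power)
  then show s: "s > 0" and "s^2 = z^2 - 1" by (simp_all add: s_def)
  show "w > 0" unfolding w_def s_def[symmetric] using s z by simp
qed

lemma norm_inverse_square_less_1: "norm x < 1"
proof -
  have "1 / z^2 < 1" using legendre_arg_pos(1,4) by (simp add: divide_less_eq)
  then show ?thesis by (simp add: x_def norm_divide norm_power)
qed

lemma csqrt_one_minus_inverse_square: "csqrt (1 - x) = of_real r"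
proof -
  have "1 - 1 / z^2 = r^2"
    using legendre_arg_pos by (simp add: r_def power_divide field_simps)
  then have "1 - x = of_real (r^2)"
    unfolding x_def by (metis of_real_1 of_real_diff)
  moreover have "r > 0" using legendre_arg_pos by (simp add: r_def)
  ultimately show ?thesis by (simp add: csqrt_of_real del: of_real_power)
qed

text \<open>Since 1 + r = w / z, the logarithms of all bases reduce to those of 2, z, s and
  w.\<close>

lemma ln_radial:
  "ln (z^2 - 1) = 2 * ln s"
  "of_real (2 / (1 + r)) = (2 / (1 + of_real r) :: complex)"
  "ln (2 / (1 + r)) = ln 2 + ln z - ln w" "2 / (1 + r) > 0"
proof -
  show "ln (z^2 - 1) = 2 * ln s"
    unfolding legendre_arg_pos(5)[symmetric] using legendre_arg_pos(2) by (simp add: ln_realpow)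
  show "of_real (2 / (1 + r)) = (2 / (1 + of_real r) :: complex)"
    by simp
  have "2 / (1 + r) = 2 * z / w"
    using legendre_arg_pos unfolding r_def w_def s_def[symmetric] by (simp add: field_simps)
  then show "ln (2 / (1 + r)) = ln 2 + ln z - ln w"  "2 / (1 + r) > 0"
    using legendre_arg_pos by (simp_all add: ln_div ln_mult)
qed

text \<open>Both signs are treated at once: k = m for +, k = -m - 1 for -, the power of 1 / r being
  m + 1 or -m accordingly. All bases are positive, so each side is sqrt pi times the exponential of
  a linear form in ln 2, ln z, ln s, ln w. On the left the coefficients add up to -1/2, 0, -1/2,
  -\<alpha>.\<close>

lemma legendre_prefactor:
  fixes \<alpha> \<mu> :: complex and k :: int
  assumes "\<mu> = 1/2 + of_int k"
  shows "of_real (sqrt pi) / 2 powr (-1/2 + \<alpha> + 1) *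
     (of_real (z^2 - 1) powr (\<mu> / 2) / of_real z powr (-1/2 + \<alpha> + \<mu> + 1)) *
     ((2 / (1 + of_real r)) powr \<alpha> * (1 / of_real r) powi (k + 1)) =
     of_real (sqrt (pi/2)) * of_real ((z^2 - 1) powr (-1/4)) * of_real w powr (-\<alpha>)"
proof -
  define L2 Lz Ls Lw where "L2 = complex_of_real (ln 2)" and "Lz = complex_of_real (ln z)"
    and "Ls = complex_of_real (ln s)" and "Lw = complex_of_real (ln w)"
  have 1: "(2 :: complex) powr c = exp (c * L2)" for c
    using powr_of_real_pos[of 2 c] by (simp add: L2_def)
  have 2: "of_real (z^2 - 1) powr c = exp (c * (2 * Ls))" for c :: complex
    using powr_of_real_pos[OF legendre_arg_pos(4), of c] unfolding ln_radial Ls_def by simp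
  have 3: "of_real z powr c = exp (c * Lz)" for c :: complex
    using powr_of_real_pos[OF legendre_arg_pos(1), of c] unfolding Lz_def .
  have 4: "(2 / (1 + of_real r)) powr c = exp (c * (L2 + Lz - Lw))" for c :: complex
    using powr_of_real_pos[OF ln_radial(4), of c] unfolding ln_radial L2_def Lz_def Lw_def by simp
  have 5: "of_real w powr c = exp (c * Lw)" for c :: complex
    using powr_of_real_pos[OF legendre_arg_pos(3), of c] unfolding Lw_def .
  have 6: "(1 / of_real r) powi n = exp (of_int n * (Lz - Ls))" for n
  proof -
    have "1 / complex_of_real r = exp (Lz - Ls)"
      using legendre_arg_pos unfolding Lz_def Ls_def r_def by (simp add: exp_diff exp_of_real)
    then show ?thesis by (simp add: exp_power_int)
  qed
  have 7: "complex_of_real ((z^2 - 1) powr (-1/4)) = exp (-1/4 * (2 * Ls))"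
    using 2[of "-1/4"] legendre_arg_pos(4) by (subst powr_of_real[symmetric]) auto
  have 8: "complex_of_real (sqrt (pi/2)) = of_real (sqrt pi) * exp (-(1/2) * L2)"
  proof -
    have "(2 :: real) powr (-(1/2)) = inverse (sqrt 2)"
      by (simp only: powr_minus powr_half_sqrt zero_le_numeral)
    then have "sqrt (pi / 2) = sqrt pi * 2 powr (-(1/2))"
      unfolding real_sqrt_divide by (simp only:) (simp only: divide_inverse)
    moreover have "complex_of_real (2 powr (-(1/2))) = exp (-(1/2) * L2)"
      using 1[of "-(1/2)"] by (subst powr_of_real[symmetric]) auto
    ultimately show ?thesis by (simp only: of_real_mult)
  qed
  have "exp (- (-1/2 + \<alpha> + 1) * L2) * (exp (\<mu> / 2 * (2 * Ls)) * exp (- (-1/2 + \<alpha> + \<mu> + 1) * Lz)) *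
     (exp (\<alpha> * (L2 + Lz - Lw)) * exp (of_int (k + 1) * (Lz - Ls))) =
     exp (-(1/2) * L2) * exp (-1/4 * (2 * Ls)) * exp (-\<alpha> * Lw)"
    unfolding exp_add[symmetric] assms by (rule arg_cong[where f = exp]) (simp add: field_simps)
  moreover have "a / exp (c * d) = a * exp (- c * d)" for a c d :: complex
    by (simp add: exp_minus divide_inverse)
  ultimately show ?thesis
    unfolding 1 2 3 4 5 6 7 8 by (simp only: mult.assoc)
qed

lemma legendre_Qhat_generic_plus:
  assumes c: "\<alpha> + 1 \<notin> \<int>\<^sub>\<le>\<^sub>0"
  shows "legendre_Qhat_generic (-1/2 + \<alpha>) (1/2 + of_nat m) z = Qhat_core m z \<alpha>"
proof -
  have args: "-1/2 + \<alpha> + (1/2 + of_nat m) + 1 = \<alpha> + 1 + of_nat m" "-1/2 + \<alpha> + 3/2 = \<alpha> + 1"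
    "(-1/2 + \<alpha>) / 2 + (1/2 + of_nat m) / 2 + 1/2 = (\<alpha> + of_nat m + 1) / 2"
    "(-1/2 + \<alpha>) / 2 + (1/2 + of_nat m) / 2 + 1 = (\<alpha> + of_nat m + 1) / 2 + 1/2"
    by (simp_all add: field_simps)
  \<comment> \<open>The Gamma quotient is precisely the factor that
    \<open>hyp2F1_jacobi_plus\<close> attaches to the series.\<close>
  have G: "Gamma (\<alpha> + 1 + of_nat m) / Gamma (\<alpha> + 1) = pochhammer (\<alpha> + 1) m"
    using pochhammer_Gamma[OF c, of m] by simp
  have H: "pochhammer (\<alpha> + 1) m * hyp2F1 ((\<alpha> + of_nat m + 1) / 2) ((\<alpha> + of_nat m + 1) / 2 + 1/2) (\<alpha> + 1) x =
      fact m * ((2 / (1 + of_real r)) powr \<alpha> * (1 / of_real r) powi (int m + 1)) * poly (jacobi_poly m \<alpha> (-\<alpha>)) (of_real (z / s))"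
  proof -
    have "(1 / complex_of_real r) powi (int m + 1) = (1 / of_real r) ^ (m + 1)"
      using power_int_of_nat[of "1 / complex_of_real r" "m + 1"] by (simp add: add.commute)
    moreover have "complex_of_real (z / s) = 1 / of_real r"
      by (simp add: r_def)
    ultimately show ?thesis
      using hyp2F1_jacobi_plus[OF c norm_inverse_square_less_1, of m] unfolding csqrt_one_minus_inverse_square by (simp only: mult.assoc)
  qed
  have "legendre_Qhat_generic (-1/2 + \<alpha>) (1/2 + of_nat m) z =
     (of_real (sqrt pi) / 2 powr (-1/2 + \<alpha> + 1)
     * (of_real (z^2 - 1) powr ((1/2 + of_nat m) / 2) / of_real z powr (-1/2 + \<alpha> + (1/2 + of_nat m) + 1)))
     * (pochhammer (\<alpha> + 1) m * hyp2F1 ((\<alpha> + of_nat m + 1) / 2) ((\<alpha> + of_nat m + 1) / 2 + 1/2) (\<alpha> + 1) x)"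
    unfolding legendre_Qhat_generic_def args x_def G by (simp only: mult_ac)
  also have "\<dots> = fact m * poly (jacobi_poly m \<alpha> (-\<alpha>)) (of_real (z / s)) *
     (of_real (sqrt pi) / 2 powr (-1/2 + \<alpha> + 1) *
     (of_real (z^2 - 1) powr ((1/2 + of_nat m) / 2) / of_real z powr (-1/2 + \<alpha> + (1/2 + of_nat m) + 1)) *
     ((2 / (1 + of_real r)) powr \<alpha> * (1 / of_real r) powi (int m + 1)))"
    unfolding H by (simp only: mult_ac)
  also have "\<dots> = fact m * poly (jacobi_poly m \<alpha> (-\<alpha>)) (of_real (z / s)) *
     (of_real (sqrt (pi/2)) * of_real ((z^2 - 1) powr (-1/4)) * of_real w powr (-\<alpha>))"
    by (subst legendre_prefactor[where k = "int m"]) simp_all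
  also have "\<dots> = Qhat_core m z \<alpha>"
    unfolding Qhat_core_def w_def s_def by (simp only: mult_ac)
  finally show ?thesis .
qed

text \<open>The denominator arises by reaching Gamma(\<alpha> + m + 1) in two ways: in 2 m + 1 steps
  from Gamma(\<alpha> - m), and in m steps from Gamma(\<alpha> + 1).\<close>

lemma legendre_Qhat_generic_minus:
  assumes c: "\<alpha> + 1 \<notin> \<int>\<^sub>\<le>\<^sub>0" and nz: "pochhammer (\<alpha> - of_nat m) (2*m + 1) \<noteq> 0"
  shows "legendre_Qhat_generic (-1/2 + \<alpha>) (-(1/2 + of_nat m)) z =
           Qhat_core m z \<alpha> / pochhammer (\<alpha> - of_nat m) (2*m + 1)"
proof -
  let ?D = "pochhammer (\<alpha> - of_nat m) (2*m + 1)"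
  define \<mu> where "\<mu> = 1/2 + complex_of_int (- int m - 1)"
  have \<mu>: "-(1/2 + of_nat m) = \<mu>"
    by (simp add: \<mu>_def)
  have args: "-1/2 + \<alpha> + \<mu> + 1 = \<alpha> - of_nat m" "-1/2 + \<alpha> + 3/2 = \<alpha> + 1"
    "(-1/2 + \<alpha>) / 2 + \<mu> / 2 + 1/2 = (\<alpha> - of_nat m) / 2"
    "(-1/2 + \<alpha>) / 2 + \<mu> / 2 + 1 = (\<alpha> - of_nat m) / 2 + 1/2"
    by (simp_all add: \<mu>_def field_simps)
  \<comment> \<open>If \<alpha> - m = -j, then the nonvanishing product forces j to be at least 2 m
    + 1, and \<alpha> + 1 = -(j - m - 1) would be a non-positive integer.\<close>
  have "\<alpha> - of_nat m \<notin> \<int>\<^sub>\<le>\<^sub>0"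
  proof
    assume "\<alpha> - of_nat m \<in> \<int>\<^sub>\<le>\<^sub>0"
    then obtain j where j: "\<alpha> - of_nat m = - of_nat j"
      by (elim nonpos_Ints_cases')
    then have "j \<ge> 2 * m + 1"
      using nz unfolding pochhammer_eq_0_iff by (metis not_less)
    then have "\<alpha> + 1 = - of_nat (j - m - 1)"
      using j by (simp add: of_nat_diff algebra_simps)
    with c show False by simp
  qed
  moreover have "\<alpha> - of_nat m + of_nat (2 * m + 1) = \<alpha> + 1 + of_nat m"
    by simp
  ultimately have "Gamma (\<alpha> - of_nat m) * ?D = Gamma (\<alpha> + 1 + of_nat m)"
    using pochhammer_Gamma[of "\<alpha> - of_nat m" "2 * m + 1"] Gamma_eq_zero_iff[of "\<alpha> - of_nat m"]
    by (simp only: nonzero_mult_div_cancel_left times_divide_eq_right simp_thms)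
  also have "\<dots> = pochhammer (\<alpha> + 1) m * Gamma (\<alpha> + 1)"
    using pochhammer_Gamma[OF c, of m] Gamma_eq_zero_iff[of "\<alpha> + 1"] c by simp
  finally have G: "Gamma (\<alpha> - of_nat m) / Gamma (\<alpha> + 1) = pochhammer (\<alpha> + 1) m / ?D"
    using nz c Gamma_eq_zero_iff[of "\<alpha> + 1"] by (subst frac_eq_eq) simp_all
  have H: "pochhammer (\<alpha> + 1) m * hyp2F1 ((\<alpha> - of_nat m) / 2) ((\<alpha> - of_nat m) / 2 + 1/2) (\<alpha> + 1) x =
      fact m * ((2 / (1 + of_real r)) powr \<alpha> * (1 / of_real r) powi (- int m - 1 + 1)) * poly (jacobi_poly m \<alpha> (-\<alpha>)) (of_real (z / s))"
  proof -
    have "(1 / complex_of_real r) powi (- int m - 1 + 1) = of_real r ^ m"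
      by (simp add: power_int_minus power_divide)
    moreover have "complex_of_real (z / s) = 1 / of_real r"
      by (simp add: r_def)
    ultimately show ?thesis
      using hyp2F1_jacobi_minus[OF c norm_inverse_square_less_1, of m] unfolding csqrt_one_minus_inverse_square by (simp only: mult.assoc)
  qed
  have "legendre_Qhat_generic (-1/2 + \<alpha>) \<mu> z =
     (of_real (sqrt pi) / 2 powr (-1/2 + \<alpha> + 1)
     * (of_real (z^2 - 1) powr (\<mu> / 2) / of_real z powr (-1/2 + \<alpha> + \<mu> + 1)))
     * (pochhammer (\<alpha> + 1) m * hyp2F1 ((\<alpha> - of_nat m) / 2) ((\<alpha> - of_nat m) / 2 + 1/2) (\<alpha> + 1) x) / ?D"
    unfolding legendre_Qhat_generic_def args x_def G divide_inverse[of _ ?D] by (simp only: mult_ac)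
  also have "\<dots> = fact m * poly (jacobi_poly m \<alpha> (-\<alpha>)) (of_real (z / s)) *
     (of_real (sqrt pi) / 2 powr (-1/2 + \<alpha> + 1) *
     (of_real (z^2 - 1) powr (\<mu> / 2) / of_real z powr (-1/2 + \<alpha> + \<mu> + 1)) *
     ((2 / (1 + of_real r)) powr \<alpha> * (1 / of_real r) powi (- int m - 1 + 1))) / ?D"
    unfolding H by (simp only: mult_ac)
  also have "\<dots> = fact m * poly (jacobi_poly m \<alpha> (-\<alpha>)) (of_real (z / s)) *
     (of_real (sqrt (pi/2)) * of_real ((z^2 - 1) powr (-1/4)) * of_real w powr (-\<alpha>)) / ?D"
    by (subst legendre_prefactor[OF \<mu>_def]) (rule refl)
  also have "\<dots> = Qhat_core m z \<alpha> / ?D"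
    unfolding Qhat_core_def w_def s_def by (simp only: mult_ac)
  finally show ?thesis unfolding \<mu> .
qed

text \<open>By the explicit sum, the Jacobi polynomial at a fixed point is a polynomial in \<alpha>,
  and the power of w is an exponential in \<alpha>.\<close>

lemma isCont_Qhat_core: "isCont (Qhat_core m z) \<alpha>"
proof -
  have e: "of_real (z + sqrt (z^2 - 1)) powr c = exp (c * of_real (ln w))" for c :: complex
    using powr_of_real_pos[OF legendre_arg_pos(3), of c] unfolding w_def .
  show ?thesis
    unfolding Qhat_core_def[abs_def] poly_jacobi_poly_eq_sum e
    by (intro continuous_intros)
qed

end

section \<open>Exceptional degrees as limits\<close>

text \<open>Integers are isolated and form a closed set. With b = 3/2 this makes the generic formula
  available on a punctured neighbourhood of an exceptional degree.\<close>

lemma eventually_at_notin_Ints: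
  fixes a b :: complex
  shows "\<forall>\<^sub>F x in at a. x + b \<notin> \<int>"
proof (cases "a + b \<in> \<int>")
  case True
  have "x + b \<notin> \<int>" if "x \<noteq> a" "dist x a < 1" for x
  proof
    assume "x + b \<in> \<int>"
    with True have "(x + b) - (a + b) \<in> \<int>" by (intro Ints_diff)
    then obtain k where k: "x - a = of_int k" by (auto elim: Ints_cases)
    then have "\<bar>k\<bar> < 1"
      using that(2) by (simp add: dist_norm flip: of_int_abs)
    with k that(1) show False by simp
  qed
  then show ?thesis
    unfolding eventually_at by (intro exI[of _ 1]) auto
next
  case False
  have "open ((\<lambda>x. x + b) -` (- \<int>))"
    by (intro open_vimage open_Compl closed_Ints continuous_intros)
  then have "\<forall>\<^sub>F x in nhds a. x \<in> (\<lambda>x. x + b) -` (- \<int>)"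
    using False by (intro eventually_nhds_in_open) auto
  then show ?thesis
    by (simp add: eventually_at_filter eventually_mono)
qed

text \<open>The parameter at degree \<nu> is \<alpha> = \<nu> + 1/2. \<open>P\<close> is a side
  condition on it: trivial for +, nonvanishing of the Pochhammer product for -. It is asked for on a
  neighbourhood because the limit uses nearby degrees.\<close>

lemma legendre_Qhat_eqI:
  assumes generic: "\<And>\<alpha>. \<alpha> + 1 \<notin> \<int>\<^sub>\<le>\<^sub>0 \<Longrightarrow> P \<alpha> \<Longrightarrow> legendre_Qhat_generic (-1/2 + \<alpha>) \<mu> z = R \<alpha>"
    and P: "\<forall>\<^sub>F \<alpha> in nhds \<alpha>0. P \<alpha>" and R: "isCont R \<alpha>0"
  shows "legendre_Qhat (-1/2 + \<alpha>0) \<mu> z = R \<alpha>0"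
proof (cases "\<alpha>0 + 1 \<in> \<int>\<^sub>\<le>\<^sub>0")
  case False
  then show ?thesis
    using generic[of \<alpha>0] eventually_nhds_x_imp_x[OF P] by (simp add: legendre_Qhat_def add.commute)
next
  case True
  let ?\<nu> = "-1/2 + \<alpha>0"
  have lim: "((\<lambda>\<nu>. \<nu> + 1/2) \<longlongrightarrow> \<alpha>0) (at ?\<nu>)"
    by (rule tendsto_eq_intros refl | simp)+
  have "((\<lambda>\<nu>. R (\<nu> + 1/2)) \<longlongrightarrow> R \<alpha>0) (at ?\<nu>)"
    using R lim by (rule isCont_tendsto_compose)
  moreover have "\<forall>\<^sub>F \<nu> in at ?\<nu>. P (\<nu> + 1/2)"
    using P lim by (rule eventually_compose_filterlim)
  then have "\<forall>\<^sub>F \<nu> in at ?\<nu>. R (\<nu> + 1/2) = legendre_Qhat_generic \<nu> \<mu> z"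
    using eventually_at_notin_Ints[where a = ?\<nu> and b = "3/2"]
  proof eventually_elim
    case (elim \<nu>)
    have "\<nu> + 1/2 + 1 \<notin> \<int>\<^sub>\<le>\<^sub>0"
      using elim(2) nonpos_Ints_Int by (auto simp: add.assoc)
    with generic[of "\<nu> + 1/2"] elim(1) show ?case by simp
  qed
  ultimately have "((\<lambda>\<nu>. legendre_Qhat_generic \<nu> \<mu> z) \<longlongrightarrow> R \<alpha>0) (at ?\<nu>)"
    by (rule Lim_transform_eventually)
  then have "Lim (at ?\<nu>) (\<lambda>\<nu>. legendre_Qhat_generic \<nu> \<mu> z) = R \<alpha>0"
    by (intro tendsto_Lim) auto
  with True show ?thesis
    by (simp add: legendre_Qhat_def add.commute)
qed

lemma legendre_Qhat_plus:
  assumes "z > 1"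
  shows "legendre_Qhat (-1/2 + \<alpha>) (1/2 + of_nat m) z = Qhat_core m z \<alpha>"
  by (rule legendre_Qhat_eqI[where P = "\<lambda>_. True", OF legendre_Qhat_generic_plus[OF assms] _ isCont_Qhat_core[OF assms]])
     simp_all

lemma legendre_Qhat_minus:
  assumes "z > 1" and nz: "pochhammer (\<alpha> - of_nat m) (2*m + 1) \<noteq> 0"
  shows "legendre_Qhat (-1/2 + \<alpha>) (-(1/2 + of_nat m)) z =
           Qhat_core m z \<alpha> / pochhammer (\<alpha> - of_nat m) (2*m + 1)"
proof -
  define D where "D = (\<lambda>\<alpha>. pochhammer (\<alpha> - of_nat m :: complex) (2*m + 1))"
  have nzD: "D \<alpha> \<noteq> 0"
    using nz unfolding D_def .
  have D: "isCont D \<alpha>"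
    unfolding D_def pochhammer_prod by (intro continuous_intros)
  then have "(D \<longlongrightarrow> D \<alpha>) (nhds \<alpha>)"
    by (simp add: isCont_def tendsto_at_iff_tendsto_nhds)
  \<comment> \<open>A continuous function that is nonzero at a point stays nonzero nearby, which
    gives the side condition of \<open>legendre_Qhat_eqI\<close>.\<close>
  then have "\<forall>\<^sub>F \<alpha> in nhds \<alpha>. D \<alpha> \<noteq> 0"
    using nzD by (rule tendsto_imp_eventually_ne)
  moreover have "isCont (\<lambda>\<alpha>. Qhat_core m z \<alpha> / D \<alpha>) \<alpha>"
    using isCont_Qhat_core[OF assms(1)] D nzD by (rule isCont_divide)
  ultimately show ?thesis
    using legendre_Qhat_generic_minus[OF assms(1)] unfolding D_def
    by (intro legendre_Qhat_eqI[where P = "\<lambda>\<alpha>. pochhammer (\<alpha> - of_nat m) (2*m + 1) \<noteq> 0"])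
qed

section \<open>The hyperbolic form and the conclusion\<close>

text \<open>Positivity of sinh \<xi> fixes the sign of the square root, and cosh \<xi> + sinh \<xi>
  = exp \<xi> turns the power into an exponential.\<close>

lemma Qhat_core_cosh:
  assumes "\<xi> > 0"
  shows "Qhat_core m (cosh \<xi>) \<alpha> = of_real (sqrt (pi/2)) * fact m * of_real (sinh \<xi> powr (-1/2))
          * exp (-\<alpha> * of_real \<xi>) * poly (jacobi_poly m \<alpha> (-\<alpha>)) (of_real (cosh \<xi> / sinh \<xi>))"
proof -
  have s: "sinh \<xi> > 0" using assms by simp
  have sq: "(cosh \<xi>)\<^sup>2 - 1 = (sinh \<xi>)\<^sup>2" by (simp add: cosh_square_eq)
  have rt: "sqrt ((sinh \<xi>)\<^sup>2) = sinh \<xi>" using s by simp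
  have "((sinh \<xi>)\<^sup>2) powr (-1/4) = sinh \<xi> powr (-1/2)"
    using s powr_powr[of "sinh \<xi>" 2 "-1/4"] by simp
  moreover have "of_real (cosh \<xi> + sinh \<xi>) powr (-\<alpha>) = exp (-\<alpha> * of_real \<xi>)"
    unfolding cosh_plus_sinh by (subst powr_of_real_pos) auto
  ultimately show ?thesis
    unfolding Qhat_core_def sq rt by simp
qed

theorem theorem8p3:
  fixes m :: nat and \<alpha> :: complex
  shows
    "(\<forall>z::real. z > 1 \<longrightarrow>
        legendre_Qhat (-1/2 + \<alpha>) (1/2 + of_nat m) z
        = of_real (sqrt (pi/2)) * fact m
          * of_real ((z^2 - 1) powr (-1/4))
          * of_real (z + sqrt (z^2 - 1)) powr (-\<alpha>)
          * poly (jacobi_poly m \<alpha> (-\<alpha>)) (of_real (z / sqrt (z^2 - 1))))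
   \<and> (\<forall>\<xi>::real. \<xi> > 0 \<longrightarrow>
        legendre_Qhat (-1/2 + \<alpha>) (1/2 + of_nat m) (cosh \<xi>)
        = of_real (sqrt (pi/2)) * fact m
          * of_real (sinh \<xi> powr (-1/2))
          * exp (-\<alpha> * of_real \<xi>)
          * poly (jacobi_poly m \<alpha> (-\<alpha>)) (of_real (cosh \<xi> / sinh \<xi>)))
   \<and> (pochhammer (\<alpha> - of_nat m) (2*m + 1) \<noteq> 0 \<longrightarrow>
       (\<forall>z::real. z > 1 \<longrightarrow>
          legendre_Qhat (-1/2 + \<alpha>) (-(1/2 + of_nat m)) z
          = of_real (sqrt (pi/2)) * fact m
            * (1 / pochhammer (\<alpha> - of_nat m) (2*m + 1))
            * of_real ((z^2 - 1) powr (-1/4))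
            * of_real (z + sqrt (z^2 - 1)) powr (-\<alpha>)
            * poly (jacobi_poly m \<alpha> (-\<alpha>)) (of_real (z / sqrt (z^2 - 1))))
     \<and> (\<forall>\<xi>::real. \<xi> > 0 \<longrightarrow>
          legendre_Qhat (-1/2 + \<alpha>) (-(1/2 + of_nat m)) (cosh \<xi>)
          = of_real (sqrt (pi/2)) * fact m
            * (1 / pochhammer (\<alpha> - of_nat m) (2*m + 1))
            * of_real (sinh \<xi> powr (-1/2))
            * exp (-\<alpha> * of_real \<xi>)
            * poly (jacobi_poly m \<alpha> (-\<alpha>)) (of_real (cosh \<xi> / sinh \<xi>))))"
proof -
  let ?D = "pochhammer (\<alpha> - of_nat m) (2*m + 1)"
  have plus: "legendre_Qhat (-1/2 + \<alpha>) (1/2 + of_nat m) z = Qhat_core m z \<alpha>" if "z > 1" for z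
    using that by (rule legendre_Qhat_plus)
  have minus: "legendre_Qhat (-1/2 + \<alpha>) (-(1/2 + of_nat m)) z = Qhat_core m z \<alpha> / ?D" if "z > 1" "?D \<noteq> 0" for z
    using that by (rule legendre_Qhat_minus)
  have cosh: "cosh \<xi> > 1" if "\<xi> > 0" for \<xi> :: real
    using that cosh_real_strict_mono[of 0 \<xi>] by simp
  have reorder: "a * b * c * d * e / D = a * b * (1 / D) * c * d * e" for a b c d e D :: complex
    by simp
  show ?thesis
  proof (intro conjI allI impI, goal_cases)
    case (1 z)
    show ?case using plus[OF 1] unfolding Qhat_core_def .
  next
    case (2 \<xi>)
    show ?case using plus[OF cosh[OF 2]] unfolding Qhat_core_cosh[OF 2] .
  next
    case (3 z)
    show ?case using minus[OF 3(2,1)] unfolding Qhat_core_def reorder .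
  next
    case (4 \<xi>)
    show ?case using minus[OF cosh[OF 4(2)] 4(1)] unfolding Qhat_core_cosh[OF 4(2)] reorder .
  qed
qed

end
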